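(* Let $X=(X_t)_{t\ge 0}$ be an irreducible reversible (rate 1) continuous-time Markov chain on a finite state space $S$, with stationary distribution $\pi$ and relaxation time $t_{\mathrm{rel}}$. Let $\emptyset\neq A\subsetneq S$. Let $M$ be an $X$-irreducible component of $A^c=S\setminus A$ for which $\mathbb{E}_{\alpha_M}[T_A]$ is maximal among all $X$-irreducible components of $A^c$, where $\alpha_M$ is the quasi-stationary distribution on $M$. Then for every $t\ge 0$, $$\pi(A)\le 1-\frac{\mathbb{P}_\pi(T_A>t)}{\mathbb{P}_{\alpha_M}(T_A>t)}\le \pi(A)+2\sum_{x\in S}\pi(x)\left(\mathbb{P}_x[T_A\le 2t_{\mathrm{rel}}]\right)^2,$$ and $$\pi(A)\le 1-\frac{\mathbb{E}_\pi[T_A]}{\mathbb{E}_{\alpha_M}[T_A]}\le \pi(A)+2\sum_{x\in S}\pi(x)\left(\mathbb{P}_x[T_A\le 2t_{\mathrm{rel}}]\right)^2.$$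
   Context: Let $P$ be an irreducible transition matrix on the finite set $S$, reversible with respect to $\pi$ (i.e. $\pi(x)P(x,y)=\pi(y)P(y,x)$). The rate 1 continuous-time chain $X$ has generator $P-I$: it jumps at rate 1 from every state, and at a jump time moves from $x$ to $y$ with probability $P(x,y)$. $\mathbb{P}_\mu,\mathbb{E}_\mu$ denote the law and expectation when $X_0\sim\mu$; $\mathbb{P}_x$ is the case $\mu=\delta_x$. Hitting times: $T_x=\min\{t\ge0: X_t=x\}$ and $T_A=\min_{x\in A}T_x$. Relaxation time: $t_{\mathrm{rel}}=1/(1-\theta_2)$, where $\theta_2$ is the second largest eigenvalue of $P$. A nonempty set $B\subsetneq S$ is $X$-irreducible if $\mathbb{P}_{b_1}[T_{b_2}<T_{B^c}]>0$ for all $b_1,b_2\in B$. Any nonempty $B\subsetneq S$ is uniquely partitioned into its $X$-irreducible components, i.e. the equivalence classes of $B$ for the relation "$b_2$ can be reached from $b_1$ by the chain without leaving $B$" (symmetric by reversibility). Quasi-stationary distribution: for an $X$-irreducible set $B$, let $P_B(x,y)=P(x,y)\mathbf{1}\{x,y\in B\}$ and let $\rho$ be the spectral radius of $P_B$. Then $\alpha_B$ is the unique probability measure supported on $B$ with $\alpha_BP_B=\rho\,\alpha_B$. *)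

theory Defs
  imports "HOL-Probability.Probability"
begin

section \<open>Transition matrices and their eigenvalues\<close>

text \<open>
  A transition matrix on the finite state space \<open>S = UNIV :: 's set\<close> is given by its rows, i.e. as
  a kernel \<open>P :: 's \<Rightarrow> 's pmf\<close> with \<open>P(x,y) = pmf (P x) y\<close>.
\<close>

definition transition_matrix :: "('s::finite \<Rightarrow> 's pmf) \<Rightarrow> real^'s^'s" where
  "transition_matrix P = (\<chi> x y. pmf (P x) y)"

definition irreducible_kernel :: "('s \<Rightarrow> 's pmf) \<Rightarrow> bool" where
  "irreducible_kernel P \<longleftrightarrow> (\<forall>x y. (x, y) \<in> {(u, v). pmf (P u) v > 0}\<^sup>*)"

definition reversible_kernel :: "('s \<Rightarrow> 's pmf) \<Rightarrow> 's pmf \<Rightarrow> bool" where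
  "reversible_kernel P \<pi> \<longleftrightarrow> (\<forall>x y. pmf \<pi> x * pmf (P x) y = pmf \<pi> y * pmf (P y) x)"

definition eigenvalues :: "'a::field^'s^'s \<Rightarrow> 'a set" where
  "eigenvalues K = {c. \<exists>v. v \<noteq> 0 \<and> K *v v = c *s v}"

text \<open>
  The largest eigenvalue 1 of an irreducible transition matrix is simple, so the second largest
  element of the set of eigenvalues is also the second largest eigenvalue when eigenvalues are
  listed with multiplicity. The value is meaningful only if there are at least two states; all
  eigenvalues are real in the reversible case.
\<close>

definition second_eigenvalue :: "('s::finite \<Rightarrow> 's pmf) \<Rightarrow> real" where
  "second_eigenvalue P =
     (let E = eigenvalues (transition_matrix P) in Max (E - {Max E}))"

definition relaxation_time :: "('s::finite \<Rightarrow> 's pmf) \<Rightarrow> real" where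
  "relaxation_time P = 1 / (1 - second_eigenvalue P)"


section \<open>The rate 1 continuous-time chain\<close>

text \<open>
  A sample point \<open>\<omega> = (s, \<xi>)\<close> consists of an initial state \<open>s\<close> and an i.i.d. sequence of pairs
  \<open>\<xi> n = (g, \<tau>)\<close> with independent components: \<open>\<tau>\<close> is the Exp(1) time spent in the \<open>n\<close>-th visited
  state, and \<open>g\<close> is a random map with independent values \<open>g x \<sim> P x\<close>, telling where the chain moves
  at the end of that time. The law of the state sequence is computed in \<open>jump_chain_law\<close> below.
\<close>

definition chain_space ::
    "('s::finite \<Rightarrow> 's pmf) \<Rightarrow> 's pmf \<Rightarrow> ('s \<times> (nat \<Rightarrow> ('s \<Rightarrow> 's) \<times> real)) measure" where
  "chain_space P \<mu> =
     measure_pmf \<mu> \<Otimes>\<^sub>M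
       (\<Pi>\<^sub>M n\<in>UNIV. measure_pmf (Pi_pmf UNIV undefined P) \<Otimes>\<^sub>M
          density lborel (\<lambda>u. ennreal (exponential_density 1 u)))"

primrec jump_chain :: "'s \<times> (nat \<Rightarrow> ('s \<Rightarrow> 's) \<times> real) \<Rightarrow> nat \<Rightarrow> 's" where
  "jump_chain \<omega> 0 = fst \<omega>"
| "jump_chain \<omega> (Suc n) = fst (snd \<omega> n) (jump_chain \<omega> n)"

definition holding_time :: "'s \<times> (nat \<Rightarrow> ('s \<Rightarrow> 's) \<times> real) \<Rightarrow> nat \<Rightarrow> real" where
  "holding_time \<omega> n = snd (snd \<omega> n)"

text \<open>
  The index below is the number of jumps up to time \<open>t\<close>. It is unspecified only on the null event
  that the holding times have a bounded sequence of partial sums.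
\<close>

definition chain_at :: "real \<Rightarrow> 's \<times> (nat \<Rightarrow> ('s \<Rightarrow> 's) \<times> real) \<Rightarrow> 's" where
  "chain_at t \<omega> = jump_chain \<omega> (LEAST n. t < (\<Sum>k\<le>n. holding_time \<omega> k))"

text \<open>
  Paths are right-continuous, so the infimum is a minimum unless the set is empty, in which
  case it is \<open>\<infinity>\<close>.
\<close>

definition hitting_time :: "'s set \<Rightarrow> 's \<times> (nat \<Rightarrow> ('s \<Rightarrow> 's) \<times> real) \<Rightarrow> ennreal" where
  "hitting_time A \<omega> = Inf (ennreal ` {t. 0 \<le> t \<and> chain_at t \<omega> \<in> A})"

definition chain_prob ::
    "('s::finite \<Rightarrow> 's pmf) \<Rightarrow> 's pmf \<Rightarrow> ('s \<times> (nat \<Rightarrow> ('s \<Rightarrow> 's) \<times> real) \<Rightarrow> bool) \<Rightarrow> real" where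
  "chain_prob P \<mu> E = measure (chain_space P \<mu>) {\<omega> \<in> space (chain_space P \<mu>). E \<omega>}"

definition expected_hitting_time ::
    "('s::finite \<Rightarrow> 's pmf) \<Rightarrow> 's pmf \<Rightarrow> 's set \<Rightarrow> ennreal" where
  "expected_hitting_time P \<mu> A = (\<integral>\<^sup>+ \<omega>. hitting_time A \<omega> \<partial>chain_space P \<mu>)"


section \<open>Irreducible components and quasi-stationary distributions\<close>

definition reachable_within :: "('s::finite \<Rightarrow> 's pmf) \<Rightarrow> 's set \<Rightarrow> ('s \<times> 's) set" where
  "reachable_within P B = {(b1, b2). b1 \<in> B \<and> b2 \<in> B \<and>
     chain_prob P (return_pmf b1) (\<lambda>\<omega>. hitting_time {b2} \<omega> < hitting_time (- B) \<omega>) > 0}"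

definition irreducible_components :: "('s::finite \<Rightarrow> 's pmf) \<Rightarrow> 's set \<Rightarrow> 's set set" where
  "irreducible_components P B = B // reachable_within P B"

definition restricted_matrix :: "('s::finite \<Rightarrow> 's pmf) \<Rightarrow> 's set \<Rightarrow> real^'s^'s" where
  "restricted_matrix P B = (\<chi> x y. if x \<in> B \<and> y \<in> B then pmf (P x) y else 0)"

definition spectral_radius :: "real^'s^'s::finite \<Rightarrow> real" where
  "spectral_radius K = Max (cmod ` eigenvalues (map_matrix complex_of_real K))"

definition quasi_stationary :: "('s::finite \<Rightarrow> 's pmf) \<Rightarrow> 's set \<Rightarrow> 's pmf" where
  "quasi_stationary P B = (THE \<alpha>. set_pmf \<alpha> \<subseteq> B \<and>
     (\<chi> x. pmf \<alpha> x) v* restricted_matrix P B =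
       spectral_radius (restricted_matrix P B) *s (\<chi> x. pmf \<alpha> x))"


section \<open>Sanity checks for the construction of the chain\<close>

lemma prob_space_exponential:
  "prob_space (density lborel (\<lambda>u. ennreal (exponential_density 1 u)))"
  using prob_space_exponential_density[of 1] by simp

lemma prob_space_chain_space: "prob_space (chain_space P \<mu>)"
proof -
  interpret E: prob_space "density lborel (\<lambda>u. ennreal (exponential_density 1 u))"
    by (rule prob_space_exponential)
  interpret F: pair_prob_space "measure_pmf (Pi_pmf UNIV undefined P)"
      "density lborel (\<lambda>u. ennreal (exponential_density 1 u))" ..
  interpret G: product_prob_space "\<lambda>_::nat. measure_pmf (Pi_pmf UNIV undefined P) \<Otimes>\<^sub>M
      density lborel (\<lambda>u. ennreal (exponential_density 1 u))" UNIV ..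
  interpret H: prob_space "(\<Pi>\<^sub>M n\<in>(UNIV::nat set). measure_pmf (Pi_pmf UNIV undefined P) \<Otimes>\<^sub>M
      density lborel (\<lambda>u. ennreal (exponential_density 1 u)))"
    by (rule G.prob_space_axioms)
  interpret I: pair_prob_space "measure_pmf \<mu>"
     "(\<Pi>\<^sub>M n\<in>(UNIV::nat set). measure_pmf (Pi_pmf UNIV undefined P) \<Otimes>\<^sub>M
      density lborel (\<lambda>u. ennreal (exponential_density 1 u)))" ..
  show ?thesis unfolding chain_space_def by (rule I.prob_space_axioms)
qed

lemma jump_chain_law:
  "chain_prob P \<mu> (\<lambda>\<omega>. \<forall>i\<le>n. jump_chain \<omega> i = x i) =
     pmf \<mu> (x 0) * (\<Prod>i<n. pmf (P (x i)) (x (Suc i)))"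
proof -
  let ?E = "density lborel (\<lambda>u. ennreal (exponential_density 1 u))"
  let ?Q = "measure_pmf (Pi_pmf UNIV undefined P)"
  let ?N = "?Q \<Otimes>\<^sub>M ?E"
  let ?Pi = "\<Pi>\<^sub>M n\<in>(UNIV::nat set). ?N"
  interpret E: prob_space ?E by (rule prob_space_exponential)
  interpret F: pair_prob_space ?Q ?E ..
  interpret G: product_prob_space "\<lambda>_::nat. ?N" UNIV ..
  have H: "prob_space ?Pi" by (rule G.prob_space_axioms)
  define D where "D = (\<lambda>i. {g. g (x i) = x (Suc i)} \<times> (UNIV :: real set))"
  have D[measurable]: "D i \<in> sets ?N" for i
    unfolding D_def by (rule pair_measureI) auto
  have mD: "measure ?N (D i) = pmf (P (x i)) (x (Suc i))" for i
  proof -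
    have "measure ?N (D i) = measure ?Q {g. g (x i) = x (Suc i)} * measure ?E UNIV"
      unfolding D_def by (simp add: measure_def E.emeasure_pair_measure_Times enn2real_mult)
    also have "measure ?E UNIV = 1" using E.prob_space by simp
    also have "measure ?Q {g. g (x i) = x (Suc i)} =
        measure (map_pmf (\<lambda>g. g (x i)) (Pi_pmf UNIV undefined P)) {x (Suc i)}"
      by (simp add: vimage_def)
    also have "map_pmf (\<lambda>g. g (x i)) (Pi_pmf UNIV undefined P) = P (x i)"
      by (subst Pi_pmf_component) auto
    finally show ?thesis by (simp add: pmf.rep_eq)
  qed
  have "(\<forall>i\<le>n. jump_chain \<omega> i = x i) \<longleftrightarrow> fst \<omega> = x 0 \<and> (\<forall>i<n. snd \<omega> i \<in> D i)" for \<omega>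
  proof (induction n)
    case (Suc n)
    have "(\<forall>i\<le>Suc n. jump_chain \<omega> i = x i) \<longleftrightarrow>
        (\<forall>i\<le>n. jump_chain \<omega> i = x i) \<and> jump_chain \<omega> (Suc n) = x (Suc n)"
      by (auto simp: le_Suc_eq)
    also have "\<dots> \<longleftrightarrow> (\<forall>i\<le>n. jump_chain \<omega> i = x i) \<and> snd \<omega> n \<in> D n"
      by (auto simp: D_def mem_Times_iff)
    finally show ?case unfolding Suc by (auto simp: less_Suc_eq)
  qed simp
  hence "{\<omega> \<in> space (chain_space P \<mu>). \<forall>i\<le>n. jump_chain \<omega> i = x i} =
      {x 0} \<times> prod_emb UNIV (\<lambda>_. ?N) {..<n} (PiE {..<n} D)"
    by (auto simp: chain_space_def space_pair_measure space_PiM prod_emb_def PiE_iff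
        restrict_def extensional_def)
  moreover have "measure (chain_space P \<mu>)
        ({x 0} \<times> prod_emb UNIV (\<lambda>_. ?N) {..<n} (PiE {..<n} D)) =
      measure (measure_pmf \<mu>) {x 0} *
        measure ?Pi (prod_emb UNIV (\<lambda>_. ?N) {..<n} (PiE {..<n} D))"
    unfolding chain_space_def by (simp add: measure_def sigma_finite_measure.emeasure_pair_measure_Times[OF prob_space_imp_sigma_finite[OF H]] enn2real_mult)
  moreover have "measure ?Pi (prod_emb UNIV (\<lambda>_. ?N) {..<n} (PiE {..<n} D)) =
      (\<Prod>i<n. measure ?N (D i))"
    by (rule G.measure_PiM_emb) auto
  ultimately show ?thesis by (simp add: chain_prob_def mD pmf.rep_eq)
qed

lemma chain_at_right_continuous: "\<exists>u>t. \<forall>s\<in>{t..<u}. chain_at s \<omega> = chain_at t \<omega>"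
proof (cases "\<exists>n. t < (\<Sum>k\<le>n. holding_time \<omega> k)")
  case True
  define N where "N = (LEAST n. t < (\<Sum>k\<le>n. holding_time \<omega> k))"
  have N: "t < (\<Sum>k\<le>N. holding_time \<omega> k)"
    unfolding N_def using True by (rule LeastI_ex)
  have "chain_at s \<omega> = chain_at t \<omega>" if "s \<in> {t..<(\<Sum>k\<le>N. holding_time \<omega> k)}" for s
  proof -
    have "(LEAST n. s < (\<Sum>k\<le>n. holding_time \<omega> k)) = N"
    proof (rule Least_equality)
      fix m assume "s < (\<Sum>k\<le>m. holding_time \<omega> k)"
      hence "t < (\<Sum>k\<le>m. holding_time \<omega> k)" using that by simp
      thus "N \<le> m" unfolding N_def by (rule Least_le)
    qed (use that in auto)
    thus ?thesis by (simp add: chain_at_def N_def)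
  qed
  hence "\<forall>s\<in>{t..<(\<Sum>k\<le>N. holding_time \<omega> k)}. chain_at s \<omega> = chain_at t \<omega>" by (rule ballI)
  with N show ?thesis by (intro exI conjI)
next
  case False
  have "chain_at s \<omega> = chain_at t \<omega>" if "s \<in> {t..<t + 1}" for s
  proof -
    have "\<not> s < (\<Sum>k\<le>n. holding_time \<omega> k)" for n
      using False that by (meson atLeastLessThan_iff order.strict_trans1)
    thus ?thesis using False by (simp add: chain_at_def)
  qed
  hence "\<forall>s\<in>{t..<t + 1}. chain_at s \<omega> = chain_at t \<omega>" by (rule ballI)
  moreover have "t < t + 1" by simp
  ultimately show ?thesis by (intro exI conjI)
qed

lemma hitting_time_less_iff:
  "hitting_time A \<omega> < c \<longleftrightarrow>
     (\<exists>q. 0 \<le> q \<and> ennreal (real_of_rat q) < c \<and> chain_at (real_of_rat q) \<omega> \<in> A)"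
proof
  assume "hitting_time A \<omega> < c"
  then obtain t where t: "0 \<le> t" "chain_at t \<omega> \<in> A" "ennreal t < c"
    by (auto simp: hitting_time_def Inf_less_iff)
  obtain u where u: "t < u" "\<forall>s\<in>{t..<u}. chain_at s \<omega> = chain_at t \<omega>"
    using chain_at_right_continuous by blast
  obtain d where d: "t < d" "ennreal d < c"
  proof (cases c)
    case (real r)
    with t have "t < r" by (simp add: ennreal_less_iff)
    then obtain d where "t < d" "d < r" using dense by blast
    with real t show ?thesis by (intro that[of d]) (auto simp: ennreal_less_iff)
  next
    case top
    show ?thesis by (rule that[of "t + 1"]) (auto simp: top)
  qed
  obtain q where q: "t < real_of_rat q" "real_of_rat q < min u d"
    using of_rat_dense[of t "min u d"] u(1) d(1) by auto
  have "0 < real_of_rat q" using q(1) t(1) by linarith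
  hence q0: "0 \<le> q" by (simp add: zero_less_of_rat_iff)
  have "ennreal (real_of_rat q) \<le> ennreal d" using q(2) by (intro ennreal_leI) simp
  hence "ennreal (real_of_rat q) < c" using d(2) by (rule le_less_trans)
  moreover have "chain_at (real_of_rat q) \<omega> = chain_at t \<omega>"
    using u(2) by (rule bspec) (use q in simp)
  ultimately show "\<exists>q. 0 \<le> q \<and> ennreal (real_of_rat q) < c \<and> chain_at (real_of_rat q) \<omega> \<in> A"
    using q0 t(2) by metis
next
  assume "\<exists>q. 0 \<le> q \<and> ennreal (real_of_rat q) < c \<and> chain_at (real_of_rat q) \<omega> \<in> A"
  then obtain q where q: "0 \<le> q" "ennreal (real_of_rat q) < c" "chain_at (real_of_rat q) \<omega> \<in> A"
    by blast
  hence "ennreal (real_of_rat q) \<in> ennreal ` {t. 0 \<le> t \<and> chain_at t \<omega> \<in> A}"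
    by (intro imageI) simp
  hence "hitting_time A \<omega> \<le> ennreal (real_of_rat q)"
    unfolding hitting_time_def by (rule Inf_lower)
  thus "hitting_time A \<omega> < c" using q(2) by (rule le_less_trans)
qed

lemma driver_measurable:
  "(\<lambda>\<omega>. snd \<omega> n) \<in> chain_space P \<mu> \<rightarrow>\<^sub>M
     (measure_pmf (Pi_pmf UNIV undefined P) \<Otimes>\<^sub>M density lborel (\<lambda>u. ennreal (exponential_density 1 u)))"
  unfolding chain_space_def
  by (rule measurable_compose[OF measurable_snd measurable_component_singleton]) simp

lemma jump_chain_measurable [measurable]:
  "(\<lambda>\<omega>. jump_chain \<omega> n) \<in> chain_space P \<mu> \<rightarrow>\<^sub>M count_space UNIV"
proof (induction n)
  case 0
  have "(\<lambda>x. x) \<in> measure_pmf \<mu> \<rightarrow>\<^sub>M count_space UNIV" by simp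
  from measurable_compose[OF measurable_fst this] show ?case
    unfolding chain_space_def by simp
next
  case (Suc n)
  have "(\<lambda>x. x) \<in> measure_pmf (Pi_pmf UNIV undefined P) \<rightarrow>\<^sub>M count_space UNIV" by simp
  from measurable_compose[OF measurable_compose[OF driver_measurable measurable_fst] this]
  have *: "(\<lambda>\<omega>. fst (snd \<omega> n)) \<in> chain_space P \<mu> \<rightarrow>\<^sub>M count_space UNIV" .
  have "(\<lambda>\<omega>. (\<lambda>x \<omega>. fst (snd \<omega> n) x) (jump_chain \<omega> n) \<omega>) \<in> chain_space P \<mu> \<rightarrow>\<^sub>M count_space UNIV"
  proof (rule measurable_compose_countable[OF _ Suc])
    fix x
    show "(\<lambda>\<omega>. fst (snd \<omega> n) x) \<in> chain_space P \<mu> \<rightarrow>\<^sub>M count_space UNIV"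
      by (rule measurable_compose[OF *]) simp
  qed
  thus ?case by simp
qed

lemma holding_time_measurable [measurable]:
  "(\<lambda>\<omega>. holding_time \<omega> n) \<in> borel_measurable (chain_space P \<mu>)"
proof -
  have "(\<lambda>u. u) \<in> borel_measurable (density lborel (\<lambda>u. ennreal (exponential_density 1 u)))"
    by simp
  from measurable_compose[OF measurable_compose[OF driver_measurable measurable_snd] this]
  show ?thesis by (simp add: holding_time_def)
qed

lemma chain_at_measurable [measurable]:
  "chain_at t \<in> chain_space P \<mu> \<rightarrow>\<^sub>M count_space UNIV"
proof -
  have "(\<lambda>\<omega>. LEAST n. t < (\<Sum>k\<le>n. holding_time \<omega> k)) \<in> chain_space P \<mu> \<rightarrow>\<^sub>M count_space UNIV"
    by measurable
  from measurable_compose_countable[OF jump_chain_measurable this]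
  show ?thesis by (simp add: chain_at_def[abs_def])
qed

lemma hitting_time_measurable [measurable]:
  "hitting_time A \<in> borel_measurable (chain_space P \<mu>)"
proof (rule borel_measurableI_less)
  fix c
  show "{\<omega> \<in> space (chain_space P \<mu>). hitting_time A \<omega> < c} \<in> sets (chain_space P \<mu>)"
    unfolding hitting_time_less_iff by measurable
qed

end

theory Submission
  imports Defs
begin

text \<open>
  Put \<open>B = - A\<close> and let \<open>K\<close> be the restriction of the transition matrix to \<open>B\<close>. Both sides of the
  comparison are read off from the spectral decomposition of \<open>K\<close>. Detailed balance makes \<open>K\<close>
  self-adjoint for the inner product weighted by \<open>\<pi>\<close>, so the functions supported on \<open>B\<close> have an
  orthonormal basis \<open>C\<close> of eigenvectors \<open>c\<close> of \<open>K\<close>, with eigenvalues \<open>lam c\<close> (\<open>eigenbasis_exists\<close>).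
  Since the chain jumps at rate 1, the number of jumps up to time \<open>t\<close> is Poisson and independent of
  the jump chain (\<open>survival_series\<close>), so that \<open>x \<mapsto> P\<^sub>x(T\<^sub>A > t)\<close> is \<open>exp (- t (I - K))\<close> applied to the
  indicator of \<open>B\<close>. Writing \<open>b c\<close> for the coefficient of that indicator along \<open>c\<close>, the survival
  probability from \<open>\<pi>\<close> is the sum of \<open>(b c)\<^sup>2 exp (- (1 - lam c) t)\<close>, where the \<open>(b c)\<^sup>2\<close> add up to
  \<open>\<pi>(B) = 1 - \<pi>(A)\<close>.

  The quasi-stationary distribution of a component \<open>M\<close> has density with respect to \<open>\<pi>\<close> equal to the
  Perron eigenvector of \<open>M\<close>, which is also an eigenvector of \<open>K\<close>; hence \<open>T\<^sub>A\<close> is exponential with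
  rate \<open>1 - \<rho>\<close> under it, \<open>\<rho>\<close> being the spectral radius of \<open>M\<close>. A maximal expected hitting time
  means a maximal \<open>\<rho>\<close>, and then \<open>\<rho>\<close> is the largest of all the \<open>lam c\<close>, because an eigenvector of
  \<open>K\<close> cut down to a component on which it does not vanish is still an eigenvector
  (\<open>maximal_component_spectral_radius\<close>). Consequently the ratio of the two survival probabilities
  lies between \<open>(b c0)\<^sup>2\<close>, for an eigenvector \<open>c0\<close> with \<open>lam c0 = \<rho>\<close>, and \<open>1 - \<pi>(A)\<close>. Integrating over
  \<open>t\<close> gives the same two bounds for the ratio of the expectations.

  It remains to bound \<open>1 - \<pi>(A) - (b c0)\<^sup>2\<close>, the sum of \<open>(b c)\<^sup>2\<close> over \<open>c \<noteq> c0\<close>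
  (\<open>hitting_square_bound\<close>). The plane spanned by \<open>c0\<close> and \<open>c\<close> contains a vector orthogonal to the
  constants, whence \<open>lam c \<le> \<theta>\<^sub>2\<close> (\<open>restricted_eigenvalue_le_second\<close>). So by time \<open>2 t\<^sub>r\<^sub>e\<^sub>l\<close> the mode
  \<open>c\<close> has decayed by a factor of at most \<open>exp (- 2)\<close>. The function \<open>x \<mapsto> P\<^sub>x(T\<^sub>A \<le> 2 t\<^sub>r\<^sub>e\<^sub>l)\<close>,
  restricted to \<open>B\<close>, is the indicator of \<open>B\<close> minus the survival function, so its squared norm is at
  least \<open>(1 - exp (- 2))\<^sup>2 \<ge> 1/2\<close> times that sum.
\<close>

section \<open>Spectral theorem on an invariant subspace\<close>

text \<open>
  First variation of the Rayleigh quotient: moving from \<open>v0\<close> in the direction of the residual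
  \<open>r = L v0 - l v0\<close> changes the quadratic form by \<open>2 e (r \<bullet> r)\<close> to first order, which a maximiser
  can only allow if \<open>r = 0\<close>.
\<close>
lemma rayleigh_maximiser_is_eigenvector:
  fixes L :: "'a::euclidean_space \<Rightarrow> 'a"
  assumes lin: "linear L" and sym: "\<And>u v. L u \<bullet> v = u \<bullet> L v"
    and V: "subspace V" and inv: "\<And>v. v \<in> V \<Longrightarrow> L v \<in> V"
    and v0: "v0 \<in> V" "norm v0 = 1"
    and max: "\<And>v. v \<in> V \<Longrightarrow> L v \<bullet> v \<le> l * (v \<bullet> v)" and l: "l = L v0 \<bullet> v0"
  shows "L v0 = l *\<^sub>R v0"
proof -
  define r where "r = L v0 - l *\<^sub>R v0"
  have v00: "v0 \<bullet> v0 = 1" using v0(2) by (simp add: dot_square_norm)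
  have rV: "r \<in> V" unfolding r_def
    by (intro subspace_diff subspace_scale V inv v0(1))
  have r0: "r \<bullet> v0 = 0"
    by (simp add: r_def inner_diff_left l v00)
  have Lr: "L v0 \<bullet> r = r \<bullet> r"
    using r0 by (simp add: r_def inner_diff_left inner_diff_right inner_commute algebra_simps v00)
  define k where "k = l * (r \<bullet> r) - L r \<bullet> r"
  have bound: "2 * e * (r \<bullet> r) \<le> e\<^sup>2 * k" for e
  proof -
    have "v0 + e *\<^sub>R r \<in> V" by (intro subspace_add subspace_scale V v0(1) rV)
    from max[OF this] have
      "L v0 \<bullet> v0 + e * (L v0 \<bullet> r) + e * (L r \<bullet> v0) + e * e * (L r \<bullet> r)
         \<le> l * (1 + e * e * (r \<bullet> r))"
      using r0 by (simp add: linear_add[OF lin] linear_scale[OF lin] inner_add_left inner_add_right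
          inner_commute[of v0 r] v00 algebra_simps)
    moreover have "L r \<bullet> v0 = r \<bullet> r" using Lr sym[of r v0] by (simp add: inner_commute)
    ultimately show ?thesis unfolding k_def
      by (simp add: Lr l[symmetric] power2_eq_square algebra_simps)
  qed
  have "r \<bullet> r \<le> 0"
  proof (rule ccontr)
    assume "\<not> r \<bullet> r \<le> 0"
    hence pos: "r \<bullet> r > 0" by (simp only: not_le)
    \<comment> \<open>A step so short that the quadratic term \<open>e\<^sup>2 k\<close> is at most half of the linear one.\<close>
    define e where "e = (r \<bullet> r) / (\<bar>k\<bar> + 1)"
    have e: "e > 0" using pos by (simp add: e_def)
    have "e * k \<le> e * \<bar>k\<bar>" using e by (intro mult_left_mono) auto
    also have "\<dots> \<le> r \<bullet> r" using pos by (simp add: e_def field_simps)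
    finally have "e * (e * k) \<le> e * (r \<bullet> r)" using e by (intro mult_left_mono) auto
    hence "2 * e * (r \<bullet> r) \<le> e * (r \<bullet> r)"
      using bound[of e] by (simp add: power2_eq_square algebra_simps)
    thus False using e pos by simp
  qed
  hence "r \<bullet> r = 0" using inner_ge_zero[of r] by (rule order_antisym)
  hence "r = 0" by (simp only: inner_eq_zero_iff)
  thus ?thesis by (simp add: r_def)
qed

text \<open>
  Split off a maximiser of the Rayleigh quotient on the unit sphere of \<open>V\<close> and continue in its
  orthogonal complement inside \<open>V\<close>, which is again invariant. Working on a subspace rather than on the
  whole space is what later provides eigenvectors that vanish outside a prescribed set of states.
\<close>
theorem spectral_theorem_invariant_subspace:
  fixes L :: "'a::euclidean_space \<Rightarrow> 'a"
  assumes lin: "linear L" and sym: "\<And>u v. L u \<bullet> v = u \<bullet> L v"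
  shows "subspace V \<Longrightarrow> (\<And>v. v \<in> V \<Longrightarrow> L v \<in> V) \<Longrightarrow>
    \<exists>C. finite C \<and> pairwise orthogonal C \<and> (\<forall>c\<in>C. norm c = 1) \<and> span C = V \<and>
        (\<forall>c\<in>C. \<exists>l. L c = l *\<^sub>R c)"
proof (induction "dim V" arbitrary: V rule: less_induct)
  case less
  note V = less.prems(1) and inv = less.prems(2)
  show ?case
  proof (cases "V = {0}")
    case True
    show ?thesis by (rule exI[of _ "{}"]) (simp add: True)
  next
    case False
    then obtain u where u: "u \<in> V" "u \<noteq> 0" using subspace_0[OF V] by blast
    define D where "D = V \<inter> sphere 0 1"
    have "compact D" unfolding D_def
      by (intro closed_Int_compact closed_subspace V compact_sphere)
    moreover have "u /\<^sub>R norm u \<in> D"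
      using u by (simp add: D_def subspace_scale[OF V])
    moreover have "continuous_on D (\<lambda>v. L v \<bullet> v)"
      by (intro continuous_intros linear_continuous_on linear_conv_bounded_linear[THEN iffD1] lin)
    ultimately obtain v0 where v0: "v0 \<in> D" "\<And>v. v \<in> D \<Longrightarrow> L v \<bullet> v \<le> L v0 \<bullet> v0"
      using continuous_attains_sup[of D "\<lambda>v. L v \<bullet> v"] by blast
    define l where "l = L v0 \<bullet> v0"
    have v0V: "v0 \<in> V" "norm v0 = 1" using v0(1) by (auto simp: D_def)
    have max: "L v \<bullet> v \<le> l * (v \<bullet> v)" if "v \<in> V" for v
    proof (cases "v = 0")
      case False
      have "L (v /\<^sub>R norm v) \<bullet> (v /\<^sub>R norm v) \<le> l" unfolding l_def
        using False that by (intro v0(2)) (simp add: D_def subspace_scale[OF V])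
      thus ?thesis using False
        by (simp add: linear_scale[OF lin] dot_square_norm field_simps power2_eq_square)
    qed (simp add: linear_0[OF lin])
    have eig: "L v0 = l *\<^sub>R v0"
      by (rule rayleigh_maximiser_is_eigenvector[OF lin sym V inv v0V max l_def])
    define V' where "V' = {v \<in> V. v0 \<bullet> v = 0}"
    have V': "subspace V'"
      using V unfolding V'_def subspace_def by (simp add: inner_add_right)
    have inv': "L v \<in> V'" if "v \<in> V'" for v
      using that inv[of v] sym[of v0 v] by (simp add: V'_def eig)
    have v00: "v0 \<bullet> v0 = 1" using v0V(2) by (simp add: dot_square_norm)
    have "V' \<subseteq> V" "v0 \<in> V - V'" using v0V(1) v00 by (auto simp: V'_def)
    hence "V' \<subset> V" by blast
    moreover have "span V' = V'" "span V = V" using V V' by (auto simp: span_eq_iff)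
    ultimately have "dim V' < dim V" by (intro dim_psubset) (simp only:)
    from less.hyps[OF this V' inv'] obtain C where
      C: "finite C" "pairwise orthogonal C" "\<forall>c\<in>C. norm c = 1" "span C = V'"
        "\<forall>c\<in>C. \<exists>l. L c = l *\<^sub>R c" by blast
    have CV': "c \<in> V'" if "c \<in> C" for c using C(4) span_base[OF that] by simp
    have "span (insert v0 C) = V"
    proof
      show "span (insert v0 C) \<subseteq> V"
        using v0V(1) CV' V by (intro span_minimal) (auto simp: V'_def)
      show "V \<subseteq> span (insert v0 C)"
      proof
        fix v assume v: "v \<in> V"
        have "v - (v0 \<bullet> v) *\<^sub>R v0 \<in> V'"
          using v v0V(1) v00 by (simp add: V'_def inner_diff_right subspace_diff[OF V] subspace_scale[OF V])
        thus "v \<in> span (insert v0 C)"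
          by (subst span_breakdown_eq) (auto simp: C(4))
      qed
    qed
    moreover have "pairwise orthogonal (insert v0 C)"
      using C(2) CV' by (auto simp: pairwise_insert orthogonal_def V'_def inner_commute)
    ultimately show ?thesis using C v0V(2) eig
      by (intro exI[of _ "insert v0 C"]) auto
  qed
qed

section \<open>Restrictions of a reversible transition matrix\<close>

definition weighted_inner :: "'s pmf \<Rightarrow> real^'s \<Rightarrow> real^'s::finite \<Rightarrow> real" where
  "weighted_inner \<pi> u v = (\<Sum>x\<in>UNIV. pmf \<pi> x * u $ x * v $ x)"

definition supported_on :: "'s set \<Rightarrow> (real^'s::finite) set" where
  "supported_on B = {v. \<forall>x. x \<notin> B \<longrightarrow> v $ x = 0}"

definition indicator_vec :: "'s set \<Rightarrow> real^'s::finite" where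
  "indicator_vec B = (\<chi> x. indicator B x)"

lemma weighted_inner_commute: "weighted_inner \<pi> u v = weighted_inner \<pi> v u"
  by (simp add: weighted_inner_def mult_ac)

lemma weighted_inner_add_left: "weighted_inner \<pi> (u + v) w = weighted_inner \<pi> u w + weighted_inner \<pi> v w"
  by (simp add: weighted_inner_def sum.distrib algebra_simps)

lemma weighted_inner_diff_left: "weighted_inner \<pi> (u - v) w = weighted_inner \<pi> u w - weighted_inner \<pi> v w"
  by (simp add: weighted_inner_def sum_subtractf algebra_simps)

lemma weighted_inner_scaleR_left: "weighted_inner \<pi> (a *\<^sub>R u) v = a * weighted_inner \<pi> u v"
  by (simp add: weighted_inner_def sum_distrib_left mult_ac)

lemma weighted_inner_zero_left [simp]: "weighted_inner \<pi> 0 v = 0"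
  by (simp add: weighted_inner_def)

lemma weighted_inner_sum_left: "weighted_inner \<pi> (\<Sum>i\<in>I. f i) v = (\<Sum>i\<in>I. weighted_inner \<pi> (f i) v)"
  by (induction I rule: infinite_finite_induct) (auto simp: weighted_inner_add_left)

lemma weighted_inner_add_right: "weighted_inner \<pi> w (u + v) = weighted_inner \<pi> w u + weighted_inner \<pi> w v"
  by (simp add: weighted_inner_add_left weighted_inner_commute[of _ w])

lemma weighted_inner_scaleR_right: "weighted_inner \<pi> v (a *\<^sub>R u) = a * weighted_inner \<pi> v u"
  by (simp add: weighted_inner_scaleR_left weighted_inner_commute[of _ v])

lemma subspace_supported_on: "subspace (supported_on B)"
  by (auto simp: subspace_def supported_on_def)

lemma indicator_vec_supported: "indicator_vec B \<in> supported_on B"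
  by (simp add: indicator_vec_def supported_on_def)

lemma restricted_matrix_mult:
  "(restricted_matrix P B *v v) $ x = (if x \<in> B then \<Sum>y\<in>B. pmf (P x) y * v $ y else 0)"
  by (auto simp: restricted_matrix_def matrix_vector_mult_def if_distrib[of "\<lambda>a. a * _"] sum.If_cases
      intro!: sum.cong cong: if_cong)

lemma restricted_matrix_mult_supported: "restricted_matrix P B *v v \<in> supported_on B"
  by (simp add: supported_on_def restricted_matrix_mult)

lemma restricted_matrix_mult_of_supported:
  assumes "v \<in> supported_on B" "x \<in> B"
  shows "(restricted_matrix P B *v v) $ x = (\<Sum>y\<in>UNIV. pmf (P x) y * v $ y)"
  using assms by (auto simp: restricted_matrix_mult supported_on_def intro!: sum.mono_neutral_left)

lemma restricted_matrix_UNIV: "restricted_matrix P UNIV = transition_matrix P"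
  by (simp add: restricted_matrix_def transition_matrix_def)

lemma transition_matrix_mult: "(transition_matrix P *v v) $ x = (\<Sum>y\<in>UNIV. pmf (P x) y * v $ y)"
  by (simp add: transition_matrix_def matrix_vector_mult_def)

locale reversible_chain =
  fixes P :: "'s::finite \<Rightarrow> 's pmf" and \<pi> :: "'s pmf"
  assumes irreducible: "irreducible_kernel P" and reversible: "reversible_kernel P \<pi>"
begin

abbreviation inn :: "real^'s \<Rightarrow> real^'s \<Rightarrow> real" where "inn \<equiv> weighted_inner \<pi>"

abbreviation K :: "'s set \<Rightarrow> real^'s^'s" where "K \<equiv> restricted_matrix P"

lemma detailed_balance: "pmf \<pi> x * pmf (P x) y = pmf \<pi> y * pmf (P y) x"
  using reversible by (simp add: reversible_kernel_def)

lemma pmf_row_sum [simp]: "(\<Sum>y\<in>UNIV. pmf (P x) y) = 1"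
  by (simp add: sum_pmf_eq_1)

text \<open>
  Irreducibility in the form in which it is used: every positivity or extremality property
  that spreads along the edges and holds somewhere holds everywhere.
\<close>
lemma irreducible_closed:
  assumes "x \<in> U" and "\<And>u v. u \<in> U \<Longrightarrow> 0 < pmf (P u) v \<Longrightarrow> v \<in> U"
  shows "U = UNIV"
proof -
  have "y \<in> U" for y
  proof -
    have "(x, y) \<in> {(u, v). pmf (P u) v > 0}\<^sup>*"
      using irreducible by (simp add: irreducible_kernel_def)
    thus "y \<in> U" by (induction rule: rtrancl_induct) (use assms in auto)
  qed
  thus ?thesis by auto
qed

lemma stationary_pos: "0 < pmf \<pi> x"
proof -
  obtain x0 where x0: "x0 \<in> set_pmf \<pi>" using set_pmf_not_empty[of \<pi>] by (metis ex_in_conv)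
  have "{x. 0 < pmf \<pi> x} = UNIV"
  proof (rule irreducible_closed)
    show "x0 \<in> {x. 0 < pmf \<pi> x}" using x0 by (simp add: pmf_positive)
    fix u v assume "u \<in> {x. 0 < pmf \<pi> x}" "0 < pmf (P u) v"
    hence "0 < pmf \<pi> v * pmf (P v) u" by (simp add: detailed_balance[symmetric])
    thus "v \<in> {x. 0 < pmf \<pi> x}" by (simp add: zero_less_mult_iff)
  qed
  thus ?thesis by auto
qed

text \<open>
  Maximum principle: where a subharmonic function attains its maximum, it equals an average of
  values that are no larger, so the maximum is attained at all neighbours as well.
\<close>
lemma subharmonic_constant:
  fixes u :: "'s \<Rightarrow> real"
  assumes sub: "\<And>x. u x \<le> (\<Sum>y\<in>UNIV. pmf (P x) y * u y)"
  shows "u x = u y"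
proof -
  define m where "m = Max (range u)"
  have le: "u y \<le> m" for y unfolding m_def by (intro Max_ge) auto
  have "m \<in> range u" unfolding m_def by (intro Max_in) auto
  then obtain x0 where x0: "u x0 = m" by auto
  have "{x. u x = m} = UNIV"
  proof (rule irreducible_closed)
    show "x0 \<in> {x. u x = m}" using x0 by simp
    fix x y assume x: "x \<in> {x. u x = m}" and y: "0 < pmf (P x) y"
    have "(\<Sum>y\<in>UNIV. pmf (P x) y * (m - u y)) = m - (\<Sum>y\<in>UNIV. pmf (P x) y * u y)"
      by (simp add: right_diff_distrib sum_subtractf sum_distrib_right[symmetric])
    also have "\<dots> \<le> 0" using sub[of x] x by simp
    finally have "(\<Sum>y\<in>UNIV. pmf (P x) y * (m - u y)) = 0"
      using le by (intro antisym sum_nonneg) auto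
    hence "pmf (P x) y * (m - u y) = 0"
      using le by (subst (asm) sum_nonneg_eq_0_iff) auto
    thus "y \<in> {x. u x = m}" using y by simp
  qed
  hence "x \<in> {x. u x = m}" "y \<in> {x. u x = m}" by (simp_all only: UNIV_I)
  thus ?thesis by simp
qed

text \<open>This is detailed balance, written as an identity of bilinear forms.\<close>
lemma restricted_self_adjoint: "inn (K B *v u) v = inn u (K B *v v)"
proof -
  have "inn (K B *v u) v = (\<Sum>x\<in>B. \<Sum>y\<in>B. pmf \<pi> x * pmf (P x) y * u $ y * v $ x)"
  proof -
    have "inn (K B *v u) v = (\<Sum>x\<in>B. pmf \<pi> x * (K B *v u) $ x * v $ x)"
      unfolding weighted_inner_def by (intro sum.mono_neutral_right) (auto simp: restricted_matrix_mult)
    thus ?thesis by (simp add: restricted_matrix_mult sum_distrib_left sum_distrib_right mult.assoc)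
  qed
  also have "\<dots> = (\<Sum>x\<in>B. \<Sum>y\<in>B. pmf \<pi> y * pmf (P y) x * u $ y * v $ x)"
    by (simp add: detailed_balance)
  also have "\<dots> = (\<Sum>y\<in>B. \<Sum>x\<in>B. pmf \<pi> y * pmf (P y) x * u $ y * v $ x)" by (rule sum.swap)
  also have "\<dots> = inn u (K B *v v)"
  proof -
    have "inn u (K B *v v) = (\<Sum>x\<in>B. pmf \<pi> x * u $ x * (K B *v v) $ x)"
      unfolding weighted_inner_def by (intro sum.mono_neutral_right) (auto simp: restricted_matrix_mult)
    thus ?thesis by (simp add: restricted_matrix_mult sum_distrib_left sum_distrib_right mult_ac)
  qed
  finally show ?thesis .
qed

text \<open>
  The eigenvalue is attached to the basis vector itself, so that multiplicities are counted by the vectors; \<open>lam\<close> has no meaning outside \<open>C\<close>.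
\<close>
definition eigenbasis :: "'s set \<Rightarrow> (real^'s) set \<Rightarrow> (real^'s \<Rightarrow> real) \<Rightarrow> bool" where
  "eigenbasis B C lam \<longleftrightarrow> finite C \<and> C \<subseteq> supported_on B \<and>
     (\<forall>c\<in>C. \<forall>d\<in>C. inn c d = (if c = d then 1 else 0)) \<and>
     (\<forall>c\<in>C. K B *v c = lam c *\<^sub>R c) \<and>
     (\<forall>v\<in>supported_on B. v = (\<Sum>c\<in>C. inn v c *\<^sub>R c))"

text \<open>
  The map \<open>T\<close> that multiplies by the square root of \<open>\<pi>\<close> is an isometry from the weighted to the
  standard inner product. It preserves supports, and it conjugates the restricted matrix into
  a symmetric one, to which the spectral theorem applies.
\<close>
theorem eigenbasis_exists: "\<exists>C lam. eigenbasis B C lam"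
proof -
  define T :: "real^'s \<Rightarrow> real^'s" where "T v = (\<chi> x. sqrt (pmf \<pi> x) * v $ x)" for v
  define T' :: "real^'s \<Rightarrow> real^'s" where "T' v = (\<chi> x. v $ x / sqrt (pmf \<pi> x))" for v
  have sq: "sqrt (pmf \<pi> x) \<noteq> 0" for x using stationary_pos[of x] by simp
  have TT': "T (T' v) = v" and T'T: "T' (T v) = v" for v
    using sq by (simp_all add: T_def T'_def vec_eq_iff)
  have lin: "linear T" "linear T'"
    by (rule linearI; simp add: T_def T'_def vec_eq_iff algebra_simps add_divide_distrib)+
  have inner_T: "T u \<bullet> T v = inn u v" for u v
    unfolding inner_vec_def weighted_inner_def T_def
  proof (intro sum.cong refl)
    fix x
    have "sqrt (pmf \<pi> x) * sqrt (pmf \<pi> x) = pmf \<pi> x" by simp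
    thus "(\<chi> x. sqrt (pmf \<pi> x) * u $ x) $ x \<bullet> (\<chi> x. sqrt (pmf \<pi> x) * v $ x) $ x = pmf \<pi> x * u $ x * v $ x"
      by (simp add: mult_ac)
  qed
  have supp: "T v \<in> supported_on B \<longleftrightarrow> v \<in> supported_on B" "T' v \<in> supported_on B \<longleftrightarrow> v \<in> supported_on B" for v
    using sq by (auto simp: supported_on_def T_def T'_def)
  define L where "L v = T (K B *v T' v)" for v
  have linL: "linear L"
    unfolding L_def using linear_compose[OF linear_compose[OF lin(2) matrix_vector_mul_linear] lin(1)]
    by (simp add: o_def)
  have sym: "L u \<bullet> v = u \<bullet> L v" for u v
    using inner_T[of "K B *v T' u" "T' v"] inner_T[of "T' u" "K B *v T' v"]
      restricted_self_adjoint[of B "T' u" "T' v"]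
    by (simp add: L_def TT')
  have "L v \<in> supported_on B" for v
    unfolding L_def supp by (rule restricted_matrix_mult_supported)
  with spectral_theorem_invariant_subspace[OF linL sym subspace_supported_on]
  obtain C where C: "finite C" "pairwise orthogonal C" "\<forall>c\<in>C. norm c = 1"
      "span C = supported_on B" "\<forall>c\<in>C. \<exists>l. L c = l *\<^sub>R c" by blast
  obtain l where l: "\<And>c. c \<in> C \<Longrightarrow> L c = l c *\<^sub>R c" using C(5) by metis
  have inj: "inj_on T' C" by (metis TT' inj_onI)
  have on: "c \<bullet> d = (if c = d then 1 else 0)" if "c \<in> C" "d \<in> C" for c d
    using that C(2,3) by (auto simp: pairwise_def orthogonal_def dot_square_norm)
  have inn_T': "inn (T' c) (T' d) = c \<bullet> d" for c d using inner_T[of "T' c" "T' d"] by (simp add: TT')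
  have expand: "w = (\<Sum>c\<in>C. (w \<bullet> c) *\<^sub>R c)" if w: "w \<in> supported_on B" for w
  proof -
    obtain a where a: "w = (\<Sum>c\<in>C. a c *\<^sub>R c)"
      using w unfolding C(4)[symmetric] span_finite[OF C(1)] by auto
    have "w \<bullet> c = a c" if "c \<in> C" for c
    proof -
      have "w \<bullet> c = (\<Sum>d\<in>C. a d * (d \<bullet> c))" by (simp add: a inner_sum_left)
      also have "\<dots> = (\<Sum>d\<in>C. if d = c then a d else 0)"
        using that by (intro sum.cong) (auto simp: on)
      finally show ?thesis using that C(1) by simp
    qed
    thus ?thesis using a by simp
  qed
  have "eigenbasis B (T' ` C) (\<lambda>v. l (T v))"
    unfolding eigenbasis_def
  proof (intro conjI ballI)
    show "finite (T' ` C)" using C(1) by simp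
    show "T' ` C \<subseteq> supported_on B"
      using span_base[of _ C] by (auto simp: supp C(4))
    fix c assume "c \<in> T' ` C"
    then obtain c' where c': "c' \<in> C" "c = T' c'" by auto
    have "T' (L c') = T' (l c' *\<^sub>R c')" using l c' by simp
    thus "K B *v c = l (T c) *\<^sub>R c"
      by (simp add: L_def T'T c' TT' linear_scale[OF lin(2)])
    fix d assume "d \<in> T' ` C"
    then obtain d' where d': "d' \<in> C" "d = T' d'" by auto
    show "inn c d = (if c = d then 1 else 0)"
      using on[OF c'(1) d'(1)] inj_onD[OF inj] c' d' by (auto simp: inn_T')
  next
    fix v assume "v \<in> supported_on B"
    hence "T v = (\<Sum>c\<in>C. (T v \<bullet> c) *\<^sub>R c)" by (intro expand) (simp add: supp)
    hence "T' (T v) = T' (\<Sum>c\<in>C. (T v \<bullet> c) *\<^sub>R c)" by (rule arg_cong)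
    also have "\<dots> = (\<Sum>c\<in>C. (T v \<bullet> c) *\<^sub>R T' c)"
      by (simp only: linear_sum[OF lin(2)] linear_scale[OF lin(2)])
    finally have "T' (T v) = (\<Sum>c\<in>C. (T v \<bullet> c) *\<^sub>R T' c)" .
    moreover have "T v \<bullet> c = inn v (T' c)" for c using inner_T[of v "T' c"] by (simp add: TT')
    ultimately show "v = (\<Sum>c\<in>T' ` C. inn v c *\<^sub>R c)" by (simp add: T'T sum.reindex[OF inj])
  qed
  thus ?thesis by blast
qed

context
  fixes B :: "'s set" and C :: "(real^'s) set" and lam
  assumes basis: "eigenbasis B C lam"
begin

lemma basis_finite: "finite C" and basis_supported: "c \<in> C \<Longrightarrow> c \<in> supported_on B"
  and basis_orthonormal: "c \<in> C \<Longrightarrow> d \<in> C \<Longrightarrow> inn c d = (if c = d then 1 else 0)"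
  and basis_eigen: "c \<in> C \<Longrightarrow> K B *v c = lam c *\<^sub>R c"
  and basis_expand: "v \<in> supported_on B \<Longrightarrow> v = (\<Sum>c\<in>C. inn v c *\<^sub>R c)"
  using basis by (auto simp: eigenbasis_def)

lemma basis_expand_component:
  assumes "v \<in> supported_on B"
  shows "v $ x = (\<Sum>c\<in>C. inn v c * c $ x)"
  using arg_cong[OF basis_expand[OF assms], of "\<lambda>w. w $ x"] by simp

lemma basis_nonzero: "c \<in> C \<Longrightarrow> c \<noteq> 0"
  using basis_orthonormal[of c c] by auto

lemma parseval:
  assumes "v \<in> supported_on B"
  shows "inn v w = (\<Sum>c\<in>C. inn v c * inn w c)"
proof -
  have "inn v w = inn (\<Sum>c\<in>C. inn v c *\<^sub>R c) w" using basis_expand[OF assms]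
    by (rule arg_cong[where f = "\<lambda>u. inn u w"])
  thus ?thesis by (simp add: weighted_inner_sum_left weighted_inner_scaleR_left weighted_inner_commute[of \<pi> w])
qed

lemma restricted_inner_basis: "c \<in> C \<Longrightarrow> inn (K B *v v) c = lam c * inn v c"
  by (simp add: restricted_self_adjoint basis_eigen weighted_inner_scaleR_right)

lemma quadratic_form:
  assumes "v \<in> supported_on B"
  shows "inn (K B *v v) v = (\<Sum>c\<in>C. lam c * (inn v c)\<^sup>2)"
proof -
  have "inn (K B *v v) v = (\<Sum>c\<in>C. inn (K B *v v) c * inn v c)"
    by (rule parseval[OF restricted_matrix_mult_supported])
  also have "\<dots> = (\<Sum>c\<in>C. lam c * (inn v c)\<^sup>2)"
    by (intro sum.cong) (simp_all add: restricted_inner_basis power2_eq_square)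
  finally show ?thesis .
qed

lemma funpow_expand:
  assumes "v \<in> supported_on B"
  shows "(((*v) (K B)) ^^ n) v = (\<Sum>c\<in>C. (lam c ^ n * inn v c) *\<^sub>R c)"
proof (induction n)
  case 0
  show ?case using basis_expand[OF assms] by simp
next
  case (Suc n)
  have "K B *v (\<Sum>c\<in>C. (lam c ^ n * inn v c) *\<^sub>R c) = (\<Sum>c\<in>C. (lam c ^ n * inn v c) *\<^sub>R (K B *v c))"
    by (simp add: linear_sum[OF matrix_vector_mul_linear] linear_scale[OF matrix_vector_mul_linear])
  also have "\<dots> = (\<Sum>c\<in>C. (lam c ^ Suc n * inn v c) *\<^sub>R c)"
    by (intro sum.cong) (simp_all add: basis_eigen mult_ac)
  finally show ?case by (simp add: Suc)
qed

lemma eigenvector_in_eigenspace: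
  assumes v: "v \<in> supported_on B" and eig: "K B *v v = l *\<^sub>R v" and c: "c \<in> C" "lam c \<noteq> l"
  shows "inn v c = 0"
  using restricted_inner_basis[OF c(1), of v] c(2) by (simp add: eig weighted_inner_scaleR_left)

lemma eigenvalue_in_basis:
  assumes v: "v \<in> supported_on B" "v \<noteq> 0" and eig: "K B *v v = l *\<^sub>R v"
  shows "l \<in> lam ` C"
proof (rule ccontr)
  assume "l \<notin> lam ` C"
  hence "inn v c = 0" if "c \<in> C" for c
    using eigenvector_in_eigenspace[OF v(1) eig that] that by auto
  hence "v = 0" using basis_expand[OF v(1)] by simp
  thus False using v(2) by simp
qed

end

text \<open>
  With an eigenvalue \<open>l \<ge> 1\<close> the absolute value of the eigenvector would be subharmonic for the
  unrestricted chain, hence constant, hence zero as it vanishes outside \<open>B\<close>.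
\<close>
lemma restricted_eigenvalue_lt_1:
  assumes B: "B \<noteq> UNIV" and v: "v \<in> supported_on B" "v \<noteq> 0" and eig: "K B *v v = l *\<^sub>R v"
  shows "l < 1"
proof (rule ccontr)
  assume l: "\<not> l < 1"
  have "\<bar>v $ x\<bar> \<le> (\<Sum>y\<in>UNIV. pmf (P x) y * \<bar>v $ y\<bar>)" for x
  proof (cases "x \<in> B")
    case True
    have "\<bar>v $ x\<bar> \<le> l * \<bar>v $ x\<bar>" using l by (simp add: mult_le_cancel_right1)
    also have "\<dots> = \<bar>(K B *v v) $ x\<bar>" using l by (simp add: eig abs_mult)
    also have "\<dots> = \<bar>\<Sum>y\<in>UNIV. pmf (P x) y * v $ y\<bar>"
      using restricted_matrix_mult_of_supported[OF v(1) True] by simp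
    also have "\<dots> \<le> (\<Sum>y\<in>UNIV. \<bar>pmf (P x) y * v $ y\<bar>)" by (rule sum_abs)
    finally show ?thesis by (simp add: abs_mult)
  next
    case False
    thus ?thesis using v(1) by (simp add: supported_on_def sum_nonneg)
  qed
  hence const: "\<bar>v $ x\<bar> = \<bar>v $ y\<bar>" for x y by (rule subharmonic_constant)
  obtain a where "a \<notin> B" using B by blast
  hence "v $ a = 0" using v(1) by (simp add: supported_on_def)
  hence "v $ x = 0" for x using const[of x a] by simp
  thus False using v(2) by (simp add: vec_eq_iff)
qed

lemma constant_eigenvector: "K UNIV *v indicator_vec UNIV = indicator_vec UNIV"
  by (simp add: restricted_matrix_UNIV vec_eq_iff transition_matrix_mult indicator_vec_def)

text \<open>
  The absolute value of an eigenvector for \<open>l > 1\<close> would be subharmonic, hence constant, and an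
  average of a constant cannot be \<open>l\<close> times as large.
\<close>
lemma full_eigenvalue_le_1:
  assumes eig: "K UNIV *v v = l *\<^sub>R v" and v: "v \<noteq> 0"
  shows "l \<le> 1"
proof (rule ccontr)
  assume l: "\<not> l \<le> 1"
  have grow: "l * \<bar>v $ x\<bar> \<le> (\<Sum>y\<in>UNIV. pmf (P x) y * \<bar>v $ y\<bar>)" for x
  proof -
    have "l * \<bar>v $ x\<bar> = \<bar>(K UNIV *v v) $ x\<bar>" using l by (simp add: eig abs_mult)
    also have "\<dots> \<le> (\<Sum>y\<in>UNIV. \<bar>pmf (P x) y * v $ y\<bar>)"
      unfolding restricted_matrix_UNIV transition_matrix_mult by (rule sum_abs)
    finally show ?thesis by (simp add: abs_mult)
  qed
  have "\<bar>v $ x\<bar> \<le> l * \<bar>v $ x\<bar>" for x using l by (simp add: mult_le_cancel_right1)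
  hence const: "\<bar>v $ x\<bar> = \<bar>v $ y\<bar>" for x y
    using grow by (intro subharmonic_constant[of "\<lambda>x. \<bar>v $ x\<bar>"]) (rule order_trans)
  have "v $ x = 0" for x
  proof -
    have "(\<Sum>y\<in>UNIV. pmf (P x) y * \<bar>v $ y\<bar>) = (\<Sum>y\<in>UNIV. pmf (P x) y * \<bar>v $ x\<bar>)"
      by (intro sum.cong refl arg_cong2[where f="(*)"] const)
    hence "l * \<bar>v $ x\<bar> \<le> \<bar>v $ x\<bar>" using grow[of x] by (simp add: sum_distrib_right[symmetric])
    moreover have "1 * \<bar>v $ x\<bar> < l * \<bar>v $ x\<bar>" if "v $ x \<noteq> 0"
      using l that by (intro mult_strict_right_mono) auto
    ultimately show ?thesis by (metis mult_1 not_le)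
  qed
  thus False using v by (simp add: vec_eq_iff)
qed

text \<open>
  An eigenvector for 1 is harmonic, so the maximum principle applies. The largest eigenvalue is thus
  simple: removing its value from the set of eigenvalues removes a single basis vector, and the
  second eigenvalue bounds all the others.
\<close>
lemma eigenvalue_1_constant:
  assumes "K UNIV *v v = v"
  shows "v = (v $ x) *\<^sub>R indicator_vec UNIV"
proof -
  have "v $ z \<le> (\<Sum>y\<in>UNIV. pmf (P z) y * v $ y)" for z
    using arg_cong[OF assms, of "\<lambda>w. w $ z"] by (simp add: restricted_matrix_UNIV transition_matrix_mult)
  hence "v $ z = v $ x" for z by (rule subharmonic_constant)
  thus ?thesis by (simp add: vec_eq_iff indicator_vec_def)
qed

context
  fixes C :: "(real^'s) set" and lam
  assumes basis: "eigenbasis UNIV C lam"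
begin

lemma eigenvalues_transition_matrix: "eigenvalues (transition_matrix P) = lam ` C"
proof
  show "eigenvalues (transition_matrix P) \<subseteq> lam ` C"
    using eigenvalue_in_basis[OF basis]
    by (auto simp: eigenvalues_def restricted_matrix_UNIV[symmetric] scalar_mult_eq_scaleR supported_on_def)
  show "lam ` C \<subseteq> eigenvalues (transition_matrix P)"
    using basis_eigen[OF basis] basis_nonzero[OF basis]
    by (auto simp: eigenvalues_def restricted_matrix_UNIV[symmetric] scalar_mult_eq_scaleR)
qed

lemma Max_eigenvalue: "Max (eigenvalues (transition_matrix P)) = 1"
proof (rule Max_eqI)
  show "finite (eigenvalues (transition_matrix P))"
    using basis_finite[OF basis] by (simp add: eigenvalues_transition_matrix)
  show "y \<le> 1" if "y \<in> eigenvalues (transition_matrix P)" for y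
    using that full_eigenvalue_le_1
    by (auto simp: eigenvalues_def restricted_matrix_UNIV[symmetric] scalar_mult_eq_scaleR)
  have "indicator_vec UNIV \<noteq> (0 :: real^'s)" by (simp add: vec_eq_iff indicator_vec_def)
  thus "1 \<in> eigenvalues (transition_matrix P)"
    using constant_eigenvector
    by (auto simp: eigenvalues_def restricted_matrix_UNIV[symmetric] scalar_mult_eq_scaleR)
qed

lemma eigenvalue_le_second:
  assumes "c \<in> C" "lam c \<noteq> 1"
  shows "lam c \<le> second_eigenvalue P"
  using assms basis_finite[OF basis]
  by (simp add: second_eigenvalue_def Let_def Max_eigenvalue) (simp add: eigenvalues_transition_matrix)

text \<open>
  If every basis vector had eigenvalue 1, all of them, and so all functions, would be constant,
  which two distinct states exclude. Thus there is an eigenvalue left to be the second one.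
\<close>
lemma second_eigenvalue_lt_1:
  assumes "x \<noteq> (y::'s)"
  shows "second_eigenvalue P < 1"
proof -
  have "\<exists>c\<in>C. lam c \<noteq> 1"
  proof (rule ccontr)
    assume "\<not> (\<exists>c\<in>C. lam c \<noteq> 1)"
    hence "K UNIV *v c = c" if "c \<in> C" for c using basis_eigen[OF basis that] that by simp
    hence c: "c $ x = c $ y" if "c \<in> C" for c
      using arg_cong[OF eigenvalue_1_constant[of c x], of "\<lambda>w. w $ y"] that
      by (simp add: indicator_vec_def)
    have "v $ x = v $ y" for v :: "real^'s"
    proof -
      have v: "v $ z = (\<Sum>c\<in>C. inn v c * c $ z)" for z
        by (rule basis_expand_component[OF basis]) (simp add: supported_on_def)
      have "v $ x = (\<Sum>c\<in>C. inn v c * c $ x)" by (rule v)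
      also have "\<dots> = (\<Sum>c\<in>C. inn v c * c $ y)" by (simp add: c)
      also have "\<dots> = v $ y" by (rule v[symmetric])
      finally show ?thesis .
    qed
    from this[of "\<chi> z. if z = x then 1 else 0"] show False using assms by simp
  qed
  hence ne: "lam ` C - {1} \<noteq> {}" by auto
  have "Max (lam ` C - {1}) \<in> lam ` C - {1}"
    using ne basis_finite[OF basis] by (intro Max_in) auto
  hence "second_eigenvalue P \<in> lam ` C - {1}"
    by (simp add: second_eigenvalue_def Let_def Max_eigenvalue) (simp add: eigenvalues_transition_matrix)
  moreover have "l \<le> 1" if "l \<in> lam ` C" for l
    using that basis_eigen[OF basis] basis_nonzero[OF basis] full_eigenvalue_le_1 by auto
  ultimately show ?thesis by (metis DiffE insertI1 order_less_le)
qed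

text \<open>
  Orthogonality to the constants kills exactly the components with eigenvalue 1.
\<close>
lemma poincare:
  assumes "inn h (indicator_vec UNIV) = 0"
  shows "inn (K UNIV *v h) h \<le> second_eigenvalue P * inn h h"
proof -
  have h: "h \<in> supported_on UNIV" by (simp add: supported_on_def)
  have "inn (K UNIV *v h) h = (\<Sum>c\<in>C. lam c * (inn h c)\<^sup>2)" by (rule quadratic_form[OF basis h])
  also have "\<dots> \<le> (\<Sum>c\<in>C. second_eigenvalue P * (inn h c)\<^sup>2)"
  proof (rule sum_mono)
    fix c assume c: "c \<in> C"
    show "lam c * (inn h c)\<^sup>2 \<le> second_eigenvalue P * (inn h c)\<^sup>2"
    proof (cases "lam c = 1")
      case True
      hence "c = (c $ undefined) *\<^sub>R indicator_vec UNIV"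
        using basis_eigen[OF basis c] by (intro eigenvalue_1_constant) simp
      hence "inn h c = inn h ((c $ undefined) *\<^sub>R indicator_vec UNIV)" by (rule arg_cong)
      also have "\<dots> = (c $ undefined) * inn h (indicator_vec UNIV)" by (rule weighted_inner_scaleR_right)
      finally have "inn h c = (c $ undefined) * inn h (indicator_vec UNIV)" .
      hence "inn h c = 0" using assms by simp
      thus ?thesis by simp
    next
      case False
      thus ?thesis using eigenvalue_le_second[OF c] by (intro mult_right_mono) auto
    qed
  qed
  also have "\<dots> = second_eigenvalue P * inn h h"
    by (subst parseval[OF basis h, of h]) (simp add: sum_distrib_left power2_eq_square)
  finally show ?thesis .
qed

end

end

section \<open>Clocks and jump paths\<close>

abbreviation exp1 :: "real measure" where
  "exp1 \<equiv> density lborel (\<lambda>u. ennreal (exponential_density 1 u))"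

definition clock_space :: "(nat \<Rightarrow> real) measure" where
  "clock_space = (\<Pi>\<^sub>M n\<in>UNIV. exp1)"

text \<open>
  The time of the \<open>n\<close>-th jump, with time 0 as the zeroth, so that the \<open>n\<close>-th visited state is
  occupied from \<open>arrival \<tau> n\<close> up to \<open>arrival \<tau> (Suc n)\<close>.
\<close>
definition arrival :: "(nat \<Rightarrow> real) \<Rightarrow> nat \<Rightarrow> real" where
  "arrival \<tau> n = (\<Sum>k<n. \<tau> k)"

text \<open>
  The almost sure event on which the jump times increase strictly to infinity, so that paths are
  genuine step functions defined for all times. Divergence is tested against integers only, to keep
  the event a countable combination of measurable ones.
\<close>
definition regular_clock :: "(nat \<Rightarrow> real) \<Rightarrow> bool" where
  "regular_clock \<tau> \<longleftrightarrow> (\<forall>k. 0 < \<tau> k) \<and> (\<forall>N::nat. \<exists>n. real N < arrival \<tau> n)"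

text \<open>
  A sequence of independent pairs is a pair of independent sequences. This separates the randomness
  of the jumps from that of the holding times. It suffices to compare both measures on cylinders,
  and there Fubini's theorem reduces the claim to a product of integrals over finitely many
  coordinates.
\<close>
lemma distr_zip_PiM:
  fixes Q :: "'a measure" and E :: "'b measure"
  assumes "prob_space Q" "prob_space E"
  shows "distr ((\<Pi>\<^sub>M n\<in>(UNIV::nat set). Q) \<Otimes>\<^sub>M (\<Pi>\<^sub>M n\<in>(UNIV::nat set). E)) (\<Pi>\<^sub>M n\<in>UNIV. Q \<Otimes>\<^sub>M E)
           (\<lambda>(g, \<tau>) n. (g n, \<tau> n)) = (\<Pi>\<^sub>M n\<in>UNIV. Q \<Otimes>\<^sub>M E)"
proof -
  interpret Q: prob_space Q by fact
  interpret E: prob_space E by fact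
  interpret QE: pair_prob_space Q E ..
  interpret PQ: product_prob_space "\<lambda>_::nat. Q" UNIV ..
  interpret PE: product_prob_space "\<lambda>_::nat. E" UNIV ..
  interpret PQE: product_prob_space "\<lambda>_::nat. Q \<Otimes>\<^sub>M E" UNIV ..
  let ?M1 = "\<Pi>\<^sub>M n\<in>(UNIV::nat set). Q" and ?M2 = "\<Pi>\<^sub>M n\<in>(UNIV::nat set). E"
  let ?N = "\<Pi>\<^sub>M n\<in>(UNIV::nat set). Q \<Otimes>\<^sub>M E"
  let ?z = "\<lambda>(g, \<tau>) n. (g (n::nat), \<tau> n)"
  have z[measurable]: "?z \<in> ?M1 \<Otimes>\<^sub>M ?M2 \<rightarrow>\<^sub>M ?N"
    by (rule measurable_PiM_single') (auto simp: space_pair_measure space_PiM split_beta)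
  show ?thesis
  proof (rule PQE.PiM_eq)
    fix J :: "nat set" and F
    assume J: "finite J" and F: "\<And>j. j \<in> J \<Longrightarrow> F j \<in> sets (Q \<Otimes>\<^sub>M E)"
    let ?box = "prod_emb UNIV (\<lambda>_. Q \<Otimes>\<^sub>M E) J (\<Pi>\<^sub>E j\<in>J. F j)"
    have box: "?box \<in> sets ?N" using J F by (intro sets_PiM_I) auto
    have sect: "Pair g -` (?z -` ?box \<inter> space (?M1 \<Otimes>\<^sub>M ?M2)) =
        prod_emb UNIV (\<lambda>_. E) J (\<Pi>\<^sub>E j\<in>J. Pair (g j) -` F j)" if "g \<in> space ?M1" for g
      using that by (auto simp: prod_emb_def space_pair_measure space_PiM PiE_iff restrict_def extensional_def)
    have "emeasure (distr (?M1 \<Otimes>\<^sub>M ?M2) ?N ?z) ?box =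
        emeasure (?M1 \<Otimes>\<^sub>M ?M2) (?z -` ?box \<inter> space (?M1 \<Otimes>\<^sub>M ?M2))"
      by (rule emeasure_distr[OF z box])
    also have "\<dots> = (\<integral>\<^sup>+ g. emeasure ?M2 (Pair g -` (?z -` ?box \<inter> space (?M1 \<Otimes>\<^sub>M ?M2))) \<partial>?M1)"
      by (rule sigma_finite_measure.emeasure_pair_measure_alt[OF prob_space_imp_sigma_finite[OF PE.prob_space_axioms] measurable_sets[OF z box]])
    also have "\<dots> = (\<integral>\<^sup>+ g. (\<Prod>j\<in>J. emeasure E (Pair (g j) -` F j)) \<partial>?M1)"
    proof (rule nn_integral_cong)
      fix g assume g: "g \<in> space ?M1"
      show "emeasure ?M2 (Pair g -` (?z -` ?box \<inter> space (?M1 \<Otimes>\<^sub>M ?M2))) =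
          (\<Prod>j\<in>J. emeasure E (Pair (g j) -` F j))"
        unfolding sect[OF g] using J by (intro PE.emeasure_PiM_emb) (auto intro: sets_Pair1 F)
    qed
    also have "\<dots> = (\<integral>\<^sup>+ g. (\<Prod>j\<in>J. emeasure E (Pair (restrict g J j) -` F j)) \<partial>?M1)"
      by (intro nn_integral_cong prod.cong) auto
    also have "\<dots> = (\<integral>\<^sup>+ g. (\<Prod>j\<in>J. emeasure E (Pair (g j) -` F j))
        \<partial>distr ?M1 (\<Pi>\<^sub>M n\<in>J. Q) (\<lambda>g. restrict g J))"
    proof (rule nn_integral_distr[symmetric])
      have "(\<lambda>g. emeasure E (Pair (g j) -` F j)) \<in> borel_measurable (\<Pi>\<^sub>M n\<in>J. Q)" if "j \<in> J" for j
        using that by (intro measurable_compose[OF measurable_component_singleton[of j J "\<lambda>_. Q"]]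
            E.measurable_emeasure_Pair F) auto
      thus "(\<lambda>g. \<Prod>j\<in>J. emeasure E (Pair (g j) -` F j)) \<in>
          borel_measurable (distr ?M1 (\<Pi>\<^sub>M n\<in>J. Q) (\<lambda>g. restrict g J))"
        by (subst measurable_distr_eq1, rule borel_measurable_prod_ennreal)
    qed (rule measurable_restrict_subset, simp)
    also have "\<dots> = (\<integral>\<^sup>+ g. (\<Prod>j\<in>J. emeasure E (Pair (g j) -` F j)) \<partial>(\<Pi>\<^sub>M n\<in>J. Q))"
      by (subst PQ.distr_PiM_restrict_finite) (use J in auto)
    also have "\<dots> = (\<Prod>j\<in>J. (\<integral>\<^sup>+ q. emeasure E (Pair q -` F j) \<partial>Q))"
      using J by (intro PQ.product_nn_integral_prod) (auto intro: E.measurable_emeasure_Pair F)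
    also have "\<dots> = (\<Prod>j\<in>J. emeasure (Q \<Otimes>\<^sub>M E) (F j))"
      by (intro prod.cong refl E.emeasure_pair_measure_alt[symmetric] F)
    finally show "emeasure (distr (?M1 \<Otimes>\<^sub>M ?M2) ?N ?z) ?box =
        (\<Prod>j\<in>J. emeasure (Q \<Otimes>\<^sub>M E) (F j))" .
  qed simp
qed

lemma prob_space_clock_space: "prob_space clock_space"
  unfolding clock_space_def by (intro prob_space_PiM prob_space_exponential)

lemma space_clock_space [simp]: "space clock_space = UNIV"
  by (auto simp: clock_space_def space_PiM)

lemma sets_clock_space: "sets clock_space = sets (\<Pi>\<^sub>M n\<in>UNIV. borel)"
  unfolding clock_space_def by (rule sets_PiM_cong) auto

lemma clock_component_measurable [measurable]: "(\<lambda>\<tau>. \<tau> k) \<in> borel_measurable clock_space"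
  by (subst measurable_cong_sets[OF sets_clock_space refl]) measurable

lemma arrival_measurable [measurable]: "(\<lambda>\<tau>. arrival \<tau> n) \<in> borel_measurable clock_space"
  unfolding arrival_def by measurable

lemma regular_clock_measurable [measurable]: "Measurable.pred clock_space regular_clock"
  unfolding regular_clock_def by measurable

text \<open>The sum of \<open>n\<close> exponential times has an Erlang distribution.\<close>
lemma arrival_le_prob:
  assumes "0 \<le> t"
  shows "measure clock_space {\<tau>. arrival \<tau> n \<le> t} = 1 - (\<Sum>k<n. t ^ k * exp (- t) / fact k)"
proof (cases n)
  case 0
  interpret prob_space clock_space by (rule prob_space_clock_space)
  show ?thesis using assms prob_space by (simp add: 0 arrival_def)
next
  case (Suc m)
  interpret prob_space clock_space by (rule prob_space_clock_space)
  have d: "distr clock_space borel (\<lambda>\<tau>. \<tau> i) = exp1" for i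
  proof -
    have "distr clock_space borel (\<lambda>\<tau>. \<tau> i) = distr clock_space exp1 (\<lambda>\<tau>. \<tau> i)"
      by (rule distr_cong) auto
    thus ?thesis unfolding clock_space_def
      using distr_PiM_component[of UNIV "\<lambda>_. exp1" i] prob_space_exponential by simp
  qed
  have "distr clock_space (\<Pi>\<^sub>M n\<in>UNIV. borel) (\<lambda>\<tau>. \<tau>) = clock_space"
    by (rule distr_id2) (simp add: sets_clock_space)
  moreover have "(\<lambda>\<tau>. restrict \<tau> UNIV) = (\<lambda>\<tau>::nat \<Rightarrow> real. \<tau>)" by (simp add: fun_eq_iff)
  ultimately have "indep_vars (\<lambda>_. borel) (\<lambda>i \<tau>. \<tau> i) UNIV"
    by (subst indep_vars_iff_distr_eq_PiM) (simp_all add: d clock_space_def[symmetric])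
  hence "indep_vars (\<lambda>_. borel) (\<lambda>i \<tau>. \<tau> i) {..<n}" by (rule indep_vars_subset) simp
  moreover have "distributed clock_space lborel (\<lambda>\<tau>. \<tau> i) (exponential_density 1)" for i
    unfolding distributed_def using d[of i]
    by (simp add: exponential_density_nonneg cong: distr_cong)
  ultimately have D: "distributed clock_space lborel (\<lambda>\<tau>. \<Sum>i<n. \<tau> i) (erlang_density m 1)"
    using exponential_distributed_sum[of "{..<n}" 1 "\<lambda>i \<tau>. \<tau> i"] by (simp add: Suc lessThan_empty_iff del: sum.lessThan_Suc)
  show ?thesis using erlang_distributed_le[OF D _ assms] assms
    by (simp add: arrival_def erlang_CDF_def Suc lessThan_Suc_atMost)
qed

lemma arrival_le_prob_tendsto_0:
  assumes "0 \<le> t"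
  shows "(\<lambda>n. measure clock_space {\<tau>. arrival \<tau> n \<le> t}) \<longlonglongrightarrow> 0"
proof -
  have "(\<lambda>k. t ^ k / fact k) sums exp t" using exp_converges[of t] by (simp add: divide_inverse mult.commute)
  hence "(\<lambda>k. t ^ k / fact k * exp (- t)) sums (exp t * exp (- t))" by (rule sums_mult2)
  hence "(\<lambda>n. 1 - (\<Sum>k<n. t ^ k * exp (- t) / fact k)) \<longlonglongrightarrow> 1 - 1"
    unfolding sums_def by (intro tendsto_intros) (simp add: exp_minus)
  thus ?thesis by (simp add: arrival_le_prob[OF assms])
qed

text \<open>
  The arrival times are unbounded because the probability that \<open>n\<close> jumps occur by a given time is
  the tail of the exponential series, which tends to 0.
\<close>
lemma AE_regular_clock: "AE \<tau> in clock_space. regular_clock \<tau>"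
proof -
  interpret prob_space clock_space by (rule prob_space_clock_space)
  have "AE \<tau> in clock_space. 0 < \<tau> k" for k
  proof -
    have "AE u in exp1. 0 < u"
    proof (subst AE_density)
      have "AE u in lborel. u \<noteq> (0::real)" by (rule AE_lborel_singleton)
      thus "AE u in lborel. 0 < ennreal (exponential_density 1 u) \<longrightarrow> 0 < u"
        by eventually_elim (auto simp: exponential_density_def)
    qed simp
    thus ?thesis unfolding clock_space_def
      by (rule AE_PiM_component[OF prob_space_exponential UNIV_I])
  qed
  hence "AE \<tau> in clock_space. \<forall>k. 0 < \<tau> k" by (subst AE_all_countable) blast
  moreover have "AE \<tau> in clock_space. \<exists>n. real N < arrival \<tau> n" for N :: nat
  proof -
    define U where "U = {\<tau>. \<forall>n. arrival \<tau> n \<le> real N}"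
    have U: "U \<in> sets clock_space"
    proof -
      have "{\<tau> \<in> space clock_space. \<forall>n. arrival \<tau> n \<le> real N} \<in> sets clock_space" by measurable
      thus ?thesis by (simp add: U_def)
    qed
    have "measure clock_space U \<le> measure clock_space {\<tau>. arrival \<tau> n \<le> real N}" for n
    proof (rule finite_measure_mono)
      have "{\<tau> \<in> space clock_space. arrival \<tau> n \<le> real N} \<in> sets clock_space" by measurable
      thus "{\<tau>. arrival \<tau> n \<le> real N} \<in> sets clock_space" by simp
    qed (auto simp: U_def)
    hence "measure clock_space U \<le> 0"
      by (intro LIMSEQ_le_const[OF arrival_le_prob_tendsto_0[of "real N"]]) auto
    hence "measure clock_space U = 0" by (simp add: measure_le_0_iff)
    hence "AE \<tau> in clock_space. \<tau> \<notin> U" using U by (intro AE_not_in) (simp add: null_sets_def emeasure_eq_measure)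
    thus ?thesis by eventually_elim (auto simp: U_def not_le)
  qed
  hence "AE \<tau> in clock_space. \<forall>N::nat. \<exists>n. real N < arrival \<tau> n" by (subst AE_all_countable) blast
  ultimately show ?thesis unfolding regular_clock_def by eventually_elim blast
qed

lemma arrival_strict_mono: "regular_clock \<tau> \<Longrightarrow> strict_mono (arrival \<tau>)"
  by (rule strict_monoI_Suc) (simp add: arrival_def regular_clock_def)

text \<open>
  Consecutive Erlang distribution functions differ by one Poisson weight.
\<close>
lemma poisson_jump_count:
  assumes "0 \<le> t"
  shows "measure clock_space {\<tau>. regular_clock \<tau> \<and> arrival \<tau> n \<le> t \<and> t < arrival \<tau> (Suc n)} =
    t ^ n * exp (- t) / fact n"
proof -
  interpret prob_space clock_space by (rule prob_space_clock_space)
  let ?A = "\<lambda>n. {\<tau>. arrival \<tau> n \<le> t}"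
  have A[measurable]: "?A n \<in> sets clock_space" for n
  proof -
    have "{\<tau> \<in> space clock_space. arrival \<tau> n \<le> t} \<in> sets clock_space" by measurable
    thus ?thesis by simp
  qed
  have "measure clock_space {\<tau>. regular_clock \<tau> \<and> arrival \<tau> n \<le> t \<and> t < arrival \<tau> (Suc n)} =
      measure clock_space (?A n - ?A n \<inter> ?A (Suc n))"
  proof (rule finite_measure_eq_AE)
    show "AE \<tau> in clock_space. \<tau> \<in> {\<tau>. regular_clock \<tau> \<and> arrival \<tau> n \<le> t \<and> t < arrival \<tau> (Suc n)} \<longleftrightarrow>
        \<tau> \<in> ?A n - ?A n \<inter> ?A (Suc n)"
      using AE_regular_clock by eventually_elim auto
    have "{\<tau> \<in> space clock_space. regular_clock \<tau> \<and> arrival \<tau> n \<le> t \<and> t < arrival \<tau> (Suc n)} \<in> sets clock_space"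
      by measurable
    thus "{\<tau>. regular_clock \<tau> \<and> arrival \<tau> n \<le> t \<and> t < arrival \<tau> (Suc n)} \<in> sets clock_space" by simp
  qed measurable
  also have "\<dots> = measure clock_space (?A n) - measure clock_space (?A n \<inter> ?A (Suc n))"
    by (rule finite_measure_Diff) auto
  also have "measure clock_space (?A n \<inter> ?A (Suc n)) = measure clock_space (?A (Suc n))"
  proof (rule finite_measure_eq_AE)
    show "AE \<tau> in clock_space. \<tau> \<in> ?A n \<inter> ?A (Suc n) \<longleftrightarrow> \<tau> \<in> ?A (Suc n)"
      using AE_regular_clock
    proof eventually_elim
      case (elim \<tau>)
      have "arrival \<tau> n \<le> arrival \<tau> (Suc n)"
        using strict_monoD[OF arrival_strict_mono[OF elim], of n "Suc n"] by simp
      thus ?case by auto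
    qed
  qed auto
  finally show ?thesis by (simp add: arrival_le_prob[OF assms])
qed

text \<open>
  The jump chain is independent of the holding times. The first \<open>n\<close> steps are an event on the
  random maps alone, so its probability factors out; taking \<open>V\<close> to be the whole space identifies that
  factor with the known law of the jump chain.
\<close>
lemma path_clock_law:
  assumes V: "V \<in> sets clock_space"
  shows "chain_prob P \<mu> (\<lambda>\<omega>. (\<forall>i\<le>n. jump_chain \<omega> i = x i) \<and> holding_time \<omega> \<in> V) =
     pmf \<mu> (x 0) * (\<Prod>i<n. pmf (P (x i)) (x (Suc i))) * measure clock_space V"
proof -
  let ?Q = "measure_pmf (Pi_pmf UNIV undefined P)"
  let ?N = "?Q \<Otimes>\<^sub>M exp1"
  let ?Pi = "\<Pi>\<^sub>M n\<in>(UNIV::nat set). ?N"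
  let ?M1 = "\<Pi>\<^sub>M n\<in>(UNIV::nat set). ?Q"
  let ?z = "\<lambda>(g, \<tau>) n. (g (n::nat), \<tau> n)"
  interpret E: prob_space exp1 by (rule prob_space_exponential)
  interpret F: pair_prob_space ?Q exp1 ..
  interpret G: product_prob_space "\<lambda>_::nat. ?N" UNIV ..
  interpret G1: product_prob_space "\<lambda>_::nat. ?Q" UNIV ..
  have H: "prob_space ?Pi" by (rule G.prob_space_axioms)
  have C: "prob_space clock_space" by (rule prob_space_clock_space)
  define U where "U = {g \<in> space ?M1. \<forall>i<n. g i (x i) = x (Suc i)}"
  have U: "U \<in> sets ?M1"
  proof -
    have "(\<lambda>g. g i (x i)) \<in> ?M1 \<rightarrow>\<^sub>M count_space UNIV" for i
      by (rule measurable_compose[OF measurable_component_singleton]) auto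
    note [measurable] = this
    show ?thesis unfolding U_def by measurable
  qed
  have dist: "distr (?M1 \<Otimes>\<^sub>M clock_space) ?Pi ?z = ?Pi"
    unfolding clock_space_def by (rule distr_zip_PiM) unfold_locales
  have z: "?z \<in> ?M1 \<Otimes>\<^sub>M clock_space \<rightarrow>\<^sub>M ?Pi"
    unfolding clock_space_def
    by (rule measurable_PiM_single') (auto simp: space_pair_measure space_PiM split_beta)
  have step: "chain_prob P \<mu> (\<lambda>\<omega>. (\<forall>i\<le>n. jump_chain \<omega> i = x i) \<and> holding_time \<omega> \<in> W) =
      pmf \<mu> (x 0) * measure ?M1 U * measure clock_space W" if W: "W \<in> sets clock_space" for W
  proof -
    define D where "D = {\<xi> \<in> space ?Pi. (\<forall>i<n. fst (\<xi> i) (x i) = x (Suc i)) \<and> (\<lambda>n. snd (\<xi> n)) \<in> W}"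
    have D: "D \<in> sets ?Pi"
    proof -
      have "(\<lambda>\<xi>. fst (\<xi> i) (x i)) \<in> ?Pi \<rightarrow>\<^sub>M count_space UNIV" for i
        by (rule measurable_compose[OF measurable_component_singleton[of i]])
          (auto intro: measurable_compose[OF measurable_fst])
      note [measurable] = this
      have "(\<lambda>\<xi> n. snd (\<xi> n)) \<in> ?Pi \<rightarrow>\<^sub>M clock_space"
        unfolding clock_space_def by (rule measurable_PiM_single') (auto simp: space_PiM)
      note [measurable] = this W
      show ?thesis unfolding D_def by measurable
    qed
    have pre: "?z -` D \<inter> space (?M1 \<Otimes>\<^sub>M clock_space) = U \<times> W"
      by (auto simp: D_def U_def space_pair_measure space_PiM)
    have "(\<forall>i\<le>n. jump_chain \<omega> i = x i) \<longleftrightarrow>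
        fst \<omega> = x 0 \<and> (\<forall>i<n. fst (snd \<omega> i) (x i) = x (Suc i))" for \<omega>
    proof (induction n)
      case (Suc n)
      have "(\<forall>i\<le>Suc n. jump_chain \<omega> i = x i) \<longleftrightarrow>
          (\<forall>i\<le>n. jump_chain \<omega> i = x i) \<and> jump_chain \<omega> (Suc n) = x (Suc n)"
        by (auto simp: le_Suc_eq)
      also have "\<dots> \<longleftrightarrow> (\<forall>i\<le>n. jump_chain \<omega> i = x i) \<and> fst (snd \<omega> n) (x n) = x (Suc n)"
        by auto
      finally show ?case unfolding Suc by (auto simp: less_Suc_eq)
    qed simp
    hence "{\<omega> \<in> space (chain_space P \<mu>). (\<forall>i\<le>n. jump_chain \<omega> i = x i) \<and> holding_time \<omega> \<in> W} = {x 0} \<times> D"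
      by (auto simp: chain_space_def space_pair_measure D_def holding_time_def[abs_def])
    hence "chain_prob P \<mu> (\<lambda>\<omega>. (\<forall>i\<le>n. jump_chain \<omega> i = x i) \<and> holding_time \<omega> \<in> W) =
        pmf \<mu> (x 0) * measure ?Pi D"
      unfolding chain_prob_def using D
      by (simp add: chain_space_def measure_def enn2real_mult pmf.rep_eq
          sigma_finite_measure.emeasure_pair_measure_Times[OF prob_space_imp_sigma_finite[OF H]])
    also have "measure ?Pi D = measure (distr (?M1 \<Otimes>\<^sub>M clock_space) ?Pi ?z) D"
      by (simp only: dist)
    also have "\<dots> = measure (?M1 \<Otimes>\<^sub>M clock_space) (U \<times> W)"
      by (subst measure_distr[OF z D]) (simp only: pre)
    also have "\<dots> = measure ?M1 U * measure clock_space W"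
      using U W by (simp add: measure_def enn2real_mult
          sigma_finite_measure.emeasure_pair_measure_Times[OF prob_space_imp_sigma_finite[OF C]])
    finally show ?thesis by simp
  qed
  have "pmf \<mu> (x 0) * measure ?M1 U = pmf \<mu> (x 0) * (\<Prod>i<n. pmf (P (x i)) (x (Suc i)))"
    using step[of UNIV] prob_space.prob_space[OF C] sets.top[of clock_space] jump_chain_law[of P \<mu> n x]
    by auto
  thus ?thesis using step[OF V] by simp
qed

lemma holding_time_clock_measurable [measurable]:
  "holding_time \<in> chain_space P \<mu> \<rightarrow>\<^sub>M clock_space"
  by (subst measurable_cong_sets[OF refl sets_clock_space], rule measurable_PiM_single')
    (auto simp: holding_time_measurable)

lemma sum_finite_path_events:
  assumes "finite I" and E: "\<And>i. i \<in> I \<Longrightarrow> {\<omega> \<in> space (chain_space P \<mu>). E i \<omega>} \<in> sets (chain_space P \<mu>)"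
    and disj: "\<And>i j \<omega>. i \<in> I \<Longrightarrow> j \<in> I \<Longrightarrow> i \<noteq> j \<Longrightarrow> E i \<omega> \<Longrightarrow> \<not> E j \<omega>"
  shows "chain_prob P \<mu> (\<lambda>\<omega>. \<exists>i\<in>I. E i \<omega>) = (\<Sum>i\<in>I. chain_prob P \<mu> (E i))"
proof -
  interpret prob_space "chain_space P \<mu>" by (rule prob_space_chain_space)
  let ?F = "\<lambda>i. {\<omega> \<in> space (chain_space P \<mu>). E i \<omega>}"
  have "{\<omega> \<in> space (chain_space P \<mu>). \<exists>i\<in>I. E i \<omega>} = (\<Union>i\<in>I. ?F i)" by auto
  moreover have "disjoint_family_on ?F I"
    using disj unfolding disjoint_family_on_def by blast
  ultimately show ?thesis unfolding chain_prob_def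
    using finite_measure_finite_Union[OF \<open>finite I\<close>, of ?F] E by auto
qed

lemma holding_time_law:
  assumes V: "V \<in> sets clock_space"
  shows "chain_prob P \<mu> (\<lambda>\<omega>. holding_time \<omega> \<in> V) = measure clock_space V"
proof -
  note [measurable] = V
  let ?E = "\<lambda>s \<omega>. jump_chain \<omega> 0 = s \<and> holding_time \<omega> \<in> V"
  have "chain_prob P \<mu> (\<lambda>\<omega>. \<exists>s\<in>UNIV. ?E s \<omega>) = (\<Sum>s\<in>UNIV. chain_prob P \<mu> (?E s))"
  proof (rule sum_finite_path_events)
    fix s
    show "{\<omega> \<in> space (chain_space P \<mu>). ?E s \<omega>} \<in> sets (chain_space P \<mu>)" by measurable
  qed auto
  also have "\<dots> = (\<Sum>s\<in>UNIV. pmf \<mu> s * measure clock_space V)"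
    using path_clock_law[OF V, of P \<mu> 0 "\<lambda>_. s" for s] by simp
  also have "\<dots> = measure clock_space V"
    by (simp add: sum_distrib_right[symmetric] sum_pmf_eq_1)
  finally show ?thesis by simp
qed

lemma AE_regular_holding_time: "AE \<omega> in chain_space P \<mu>. regular_clock (holding_time \<omega>)"
proof -
  interpret prob_space "chain_space P \<mu>" by (rule prob_space_chain_space)
  interpret C: prob_space clock_space by (rule prob_space_clock_space)
  let ?V = "{\<tau>. regular_clock \<tau>}"
  have "{\<tau> \<in> space clock_space. regular_clock \<tau>} \<in> sets clock_space" by measurable
  hence V: "?V \<in> sets clock_space" by simp
  have "measure clock_space ?V = 1"
    using AE_regular_clock V by (subst C.prob_eq_1) auto
  hence "prob {\<omega> \<in> space (chain_space P \<mu>). regular_clock (holding_time \<omega>)} = 1"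
    using holding_time_law[OF V, of P \<mu>] by (simp add: chain_prob_def)
  moreover have "{\<omega> \<in> space (chain_space P \<mu>). regular_clock (holding_time \<omega>)} \<in> sets (chain_space P \<mu>)"
    using measurable_compose[OF holding_time_clock_measurable regular_clock_measurable] by measurable
  ultimately show ?thesis by (subst (asm) prob_eq_1) auto
qed

lemma arrival_interval_exists:
  assumes "regular_clock \<tau>" "0 \<le> t"
  shows "\<exists>n. arrival \<tau> n \<le> t \<and> t < arrival \<tau> (Suc n)"
proof -
  obtain N :: nat where "t < real N" using reals_Archimedean2 by blast
  moreover obtain n where "real N < arrival \<tau> n" using assms(1) by (auto simp: regular_clock_def)
  ultimately have ex: "\<exists>n. t < arrival \<tau> n" by (meson less_trans)
  define m where "m = (LEAST n. t < arrival \<tau> n)"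
  have m: "t < arrival \<tau> m" unfolding m_def using ex by (rule LeastI_ex)
  then obtain k where k: "m = Suc k" using assms(2) by (cases m) (auto simp: arrival_def)
  have "\<not> t < arrival \<tau> k" using not_less_Least[of k "\<lambda>n. t < arrival \<tau> n"] k by (simp add: m_def)
  thus ?thesis using m k by (intro exI[of _ k]) simp
qed

lemma chain_at_between_arrivals:
  assumes reg: "regular_clock (holding_time \<omega>)"
    and t: "arrival (holding_time \<omega>) n \<le> t" "t < arrival (holding_time \<omega>) (Suc n)"
  shows "chain_at t \<omega> = jump_chain \<omega> n"
proof -
  have "(LEAST n. t < (\<Sum>k\<le>n. holding_time \<omega> k)) = n"
  proof (rule Least_equality)
    show "t < (\<Sum>k\<le>n. holding_time \<omega> k)" using t(2) by (simp add: arrival_def lessThan_Suc_atMost)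
    fix m assume "t < (\<Sum>k\<le>m. holding_time \<omega> k)"
    hence "arrival (holding_time \<omega>) n < arrival (holding_time \<omega>) (Suc m)"
      using t(1) by (simp add: arrival_def lessThan_Suc_atMost)
    thus "n \<le> m" using strict_mono_less[OF arrival_strict_mono[OF reg]] by simp
  qed
  thus ?thesis by (simp add: chain_at_def)
qed

lemma hitting_time_le_arrival:
  assumes reg: "regular_clock (holding_time \<omega>)" and "jump_chain \<omega> n \<in> A"
  shows "hitting_time A \<omega> \<le> ennreal (arrival (holding_time \<omega>) n)"
proof -
  let ?a = "arrival (holding_time \<omega>)"
  have mono: "strict_mono ?a" by (rule arrival_strict_mono[OF reg])
  have "0 \<le> ?a n" using strict_mono_less_eq[OF mono, of 0 n] by (simp add: arrival_def)
  moreover have "chain_at (?a n) \<omega> \<in> A"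
    using chain_at_between_arrivals[OF reg, of n "?a n"] strict_monoD[OF mono, of n "Suc n"] assms(2) by simp
  ultimately show ?thesis unfolding hitting_time_def by (intro Inf_lower imageI) simp
qed

lemma arrival_le_hitting_time:
  assumes reg: "regular_clock (holding_time \<omega>)" and avoid: "\<And>i. i < n \<Longrightarrow> jump_chain \<omega> i \<notin> A"
  shows "ennreal (arrival (holding_time \<omega>) n) \<le> hitting_time A \<omega>"
  unfolding hitting_time_def
proof (rule Inf_greatest, clarify)
  let ?a = "arrival (holding_time \<omega>)"
  fix t assume t: "0 \<le> t" "chain_at t \<omega> \<in> A"
  obtain i where i: "?a i \<le> t" "t < ?a (Suc i)" using arrival_interval_exists[OF reg t(1)] by blast
  have "jump_chain \<omega> i \<in> A" using chain_at_between_arrivals[OF reg i] t(2) by simp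
  hence "n \<le> i" using avoid not_le by blast
  hence "?a n \<le> ?a i" using strict_mono_less_eq[OF arrival_strict_mono[OF reg]] by simp
  thus "ennreal (?a n) \<le> ennreal t" using i(1) by (intro ennreal_leI) simp
qed

text \<open>
  The path takes no values up to time \<open>t\<close> other than the states visited by then; this turns the infimum
  over real times into a condition on finitely many steps.
\<close>
lemma hitting_time_gt_iff:
  assumes reg: "regular_clock (holding_time \<omega>)" and "0 \<le> t"
  shows "hitting_time A \<omega> > ennreal t \<longleftrightarrow>
    (\<exists>n. arrival (holding_time \<omega>) n \<le> t \<and> t < arrival (holding_time \<omega>) (Suc n) \<and>
       (\<forall>i\<le>n. jump_chain \<omega> i \<notin> A))" (is "?L \<longleftrightarrow> ?R")
proof
  let ?a = "arrival (holding_time \<omega>)"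
  have mono: "strict_mono ?a" by (rule arrival_strict_mono[OF reg])
  show ?R if ?L
  proof -
    obtain n where n: "?a n \<le> t" "t < ?a (Suc n)" using arrival_interval_exists[OF assms] by blast
    have "jump_chain \<omega> i \<notin> A" if "i \<le> n" for i
    proof
      assume "jump_chain \<omega> i \<in> A"
      hence "hitting_time A \<omega> \<le> ennreal (?a i)" by (rule hitting_time_le_arrival[OF reg])
      also have "?a i \<le> t" using strict_mono_less_eq[OF mono, of i n] that n(1) by simp
      hence "ennreal (?a i) \<le> ennreal t" by (rule ennreal_leI)
      finally show False using \<open>?L\<close> by simp
    qed
    thus ?R using n by blast
  qed
  show ?L if ?R
  proof -
    from that obtain n where n: "t < ?a (Suc n)" "\<forall>i\<le>n. jump_chain \<omega> i \<notin> A" by blast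
    have "ennreal t < ennreal (?a (Suc n))" using n(1) \<open>0 \<le> t\<close> by (intro ennreal_lessI) auto
    also have "\<dots> \<le> hitting_time A \<omega>" using n(2) by (intro arrival_le_hitting_time[OF reg]) auto
    finally show ?L .
  qed
qed

text \<open>Summation over paths, with the last state innermost.\<close>
lemma sum_PiE_atMost_Suc:
  fixes f :: "(nat \<Rightarrow> 'a) \<Rightarrow> 'b::comm_monoid_add"
  shows "(\<Sum>x\<in>{..Suc n} \<rightarrow>\<^sub>E B. f x) = (\<Sum>x\<in>{..n} \<rightarrow>\<^sub>E B. \<Sum>y\<in>B. f (x(Suc n := y)))"
proof -
  have inj: "inj_on (\<lambda>(y, g). g(Suc n := y)) (B \<times> ({..n} \<rightarrow>\<^sub>E B))"
    by (rule inj_combinator) simp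
  have "{..Suc n} \<rightarrow>\<^sub>E B = (\<lambda>(y, g). g(Suc n := y)) ` (B \<times> ({..n} \<rightarrow>\<^sub>E B))"
    by (simp add: atMost_Suc PiE_insert_eq)
  hence "(\<Sum>x\<in>{..Suc n} \<rightarrow>\<^sub>E B. f x) = (\<Sum>(y, x)\<in>B \<times> ({..n} \<rightarrow>\<^sub>E B). f (x(Suc n := y)))"
    by (simp only:) (subst sum.reindex[OF inj], simp add: split_beta)
  thus ?thesis by (simp add: sum.cartesian_product[symmetric] sum.swap[of _ B])
qed

text \<open>
  Summing out the last state of a path replaces the terminal function \<open>v\<close> by the restricted matrix
  applied to \<open>v\<close>, which again vanishes outside \<open>B\<close>; hence the generality in \<open>v\<close>.
\<close>
lemma path_sum_eq_matrix_power:
  assumes "\<And>x. x \<notin> B \<Longrightarrow> v $ x = 0"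
  shows "(\<Sum>x\<in>{..n} \<rightarrow>\<^sub>E B. pmf \<mu> (x 0) * (\<Prod>i<n. pmf (P (x i)) (x (Suc i))) * v $ x n) =
    (\<Sum>x\<in>UNIV. pmf \<mu> x * ((((*v) (restricted_matrix P B)) ^^ n) v) $ x)"
  using assms
proof (induction n arbitrary: v)
  case 0
  have "(\<Sum>x\<in>{..0::nat} \<rightarrow>\<^sub>E B. pmf \<mu> (x 0) * v $ x 0) = (\<Sum>y\<in>B. pmf \<mu> y * v $ y)"
    by (rule sum.reindex_bij_witness[of _ "\<lambda>y. \<lambda>i\<in>{..0}. y" "\<lambda>x. x (0::nat)"])
      (auto simp: PiE_iff extensional_def restrict_def)
  also have "\<dots> = (\<Sum>y\<in>UNIV. pmf \<mu> y * v $ y)"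
    using 0 by (intro sum.mono_neutral_left) auto
  finally show ?case by simp
next
  case (Suc n)
  let ?K = "restricted_matrix P B"
  have "(\<Sum>x\<in>{..Suc n} \<rightarrow>\<^sub>E B. pmf \<mu> (x 0) * (\<Prod>i<Suc n. pmf (P (x i)) (x (Suc i))) * v $ x (Suc n)) =
     (\<Sum>x\<in>{..n} \<rightarrow>\<^sub>E B. \<Sum>y\<in>B. pmf \<mu> (x 0) * (\<Prod>i<n. pmf (P (x i)) (x (Suc i))) *
        (pmf (P (x n)) y * v $ y))"
    unfolding sum_PiE_atMost_Suc by (intro sum.cong refl) (simp add: mult.assoc)
  also have "\<dots> = (\<Sum>x\<in>{..n} \<rightarrow>\<^sub>E B. pmf \<mu> (x 0) * (\<Prod>i<n. pmf (P (x i)) (x (Suc i))) * (?K *v v) $ x n)"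
  proof (intro sum.cong refl)
    fix x assume "x \<in> {..n} \<rightarrow>\<^sub>E B"
    hence "x n \<in> B" by auto
    thus "(\<Sum>y\<in>B. pmf \<mu> (x 0) * (\<Prod>i<n. pmf (P (x i)) (x (Suc i))) * (pmf (P (x n)) y * v $ y)) =
      pmf \<mu> (x 0) * (\<Prod>i<n. pmf (P (x i)) (x (Suc i))) * (?K *v v) $ x n"
      by (simp add: restricted_matrix_mult sum_distrib_left)
  qed
  also have "\<dots> = (\<Sum>x\<in>UNIV. pmf \<mu> x * ((((*v) ?K) ^^ n) (?K *v v)) $ x)"
    by (rule Suc.IH) (simp add: restricted_matrix_mult)
  finally show ?case by (simp add: funpow_swap1)
qed

text \<open>
  Conditioning on the number \<open>n\<close> of jumps up to time \<open>t\<close>: it is Poisson distributed and independent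
  of the jump chain, and the \<open>n\<close>-th power of the restricted matrix sums the probabilities of the
  paths of length \<open>n\<close> that avoid \<open>A\<close>.
\<close>
theorem survival_series:
  assumes t: "0 \<le> t"
  shows "(\<lambda>n. t ^ n * exp (- t) / fact n *
      (\<Sum>x\<in>UNIV. pmf \<mu> x * ((((*v) (restricted_matrix P (- A))) ^^ n) (\<chi> x. indicator (- A) x)) $ x))
    sums chain_prob P \<mu> (\<lambda>\<omega>. hitting_time A \<omega> > ennreal t)"
proof -
  interpret prob_space "chain_space P \<mu>" by (rule prob_space_chain_space)
  define V where "V n = {\<tau>. regular_clock \<tau> \<and> arrival \<tau> n \<le> t \<and> t < arrival \<tau> (Suc n)}" for n
  have V[measurable]: "V n \<in> sets clock_space" for n
  proof -
    have "{\<tau> \<in> space clock_space. regular_clock \<tau> \<and> arrival \<tau> n \<le> t \<and> t < arrival \<tau> (Suc n)} \<in> sets clock_space"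
      by measurable
    thus ?thesis by (simp add: V_def)
  qed
  define S where "S n \<omega> \<longleftrightarrow> holding_time \<omega> \<in> V n \<and> (\<forall>i\<le>n. jump_chain \<omega> i \<in> - A)" for n and \<omega> :: "'a \<times> (nat \<Rightarrow> ('a \<Rightarrow> 'a) \<times> real)"
  let ?S = "\<lambda>n. {\<omega> \<in> space (chain_space P \<mu>). S n \<omega>}"
  have S: "?S n \<in> sets (chain_space P \<mu>)" for n unfolding S_def by measurable
  have S_law: "chain_prob P \<mu> (S n) = t ^ n * exp (- t) / fact n *
      (\<Sum>x\<in>UNIV. pmf \<mu> x * ((((*v) (restricted_matrix P (- A))) ^^ n) (\<chi> x. indicator (- A) x)) $ x)" for n
  proof -
    let ?E = "\<lambda>x \<omega>. (\<forall>i\<le>n. jump_chain \<omega> i = x i) \<and> holding_time \<omega> \<in> V n"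
    have "S n \<omega> \<longleftrightarrow> (\<exists>x\<in>{..n} \<rightarrow>\<^sub>E (- A). ?E x \<omega>)" for \<omega>
    proof
      assume "S n \<omega>"
      thus "\<exists>x\<in>{..n} \<rightarrow>\<^sub>E (- A). ?E x \<omega>"
        by (intro bexI[of _ "\<lambda>i\<in>{..n}. jump_chain \<omega> i"]) (auto simp: S_def)
    qed (auto simp: S_def PiE_iff)
    hence "chain_prob P \<mu> (S n) = chain_prob P \<mu> (\<lambda>\<omega>. \<exists>x\<in>{..n} \<rightarrow>\<^sub>E (- A). ?E x \<omega>)" by presburger
    also have "\<dots> = (\<Sum>x\<in>{..n} \<rightarrow>\<^sub>E (- A). chain_prob P \<mu> (?E x))"
    proof (rule sum_finite_path_events)
      fix x y \<omega> assume xy: "x \<in> {..n} \<rightarrow>\<^sub>E (- A)" "y \<in> {..n} \<rightarrow>\<^sub>E (- A)" "x \<noteq> y" "?E x \<omega>"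
      show "\<not> ?E y \<omega>"
      proof
        assume "?E y \<omega>"
        hence "x i = y i" if "i \<le> n" for i using xy(4) that by metis
        hence "x = y" using PiE_ext[OF xy(1,2)] by simp
        thus False using xy(3) by simp
      qed
    next
      show "{\<omega> \<in> space (chain_space P \<mu>). ?E x \<omega>} \<in> sets (chain_space P \<mu>)" for x by measurable
    qed (simp add: finite_PiE)
    also have "\<dots> = (\<Sum>x\<in>{..n} \<rightarrow>\<^sub>E (- A). pmf \<mu> (x 0) * (\<Prod>i<n. pmf (P (x i)) (x (Suc i))) *
        (\<chi> x. indicator (- A) x) $ x n) * measure clock_space (V n)"
      unfolding sum_distrib_right
      by (intro sum.cong refl) (auto simp: path_clock_law[OF V] PiE_iff)
    also have "measure clock_space (V n) = t ^ n * exp (- t) / fact n"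
      unfolding V_def by (rule poisson_jump_count[OF t])
    finally show ?thesis by (subst (asm) path_sum_eq_matrix_power) (simp_all add: mult.commute)
  qed
  have disj: "disjoint_family ?S"
  proof -
    have "n = m" if "S n \<omega>" "S m \<omega>" for n m \<omega>
    proof -
      from that have reg: "regular_clock (holding_time \<omega>)"
        and *: "arrival (holding_time \<omega>) n < arrival (holding_time \<omega>) (Suc m)"
          "arrival (holding_time \<omega>) m < arrival (holding_time \<omega>) (Suc n)"
        by (auto simp: S_def V_def)
      show ?thesis using * strict_mono_less[OF arrival_strict_mono[OF reg]] by simp
    qed
    thus ?thesis by (auto simp: disjoint_family_on_def)
  qed
  have "(\<lambda>n. measure (chain_space P \<mu>) (?S n)) sums measure (chain_space P \<mu>) (\<Union>n. ?S n)"
    by (rule finite_measure_UNION) (use S disj in auto)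
  moreover have "measure (chain_space P \<mu>) (\<Union>n. ?S n) = chain_prob P \<mu> (\<lambda>\<omega>. hitting_time A \<omega> > ennreal t)"
    unfolding chain_prob_def
  proof (rule finite_measure_eq_AE)
    show "AE \<omega> in chain_space P \<mu>. \<omega> \<in> (\<Union>n. ?S n) \<longleftrightarrow>
        \<omega> \<in> {\<omega> \<in> space (chain_space P \<mu>). hitting_time A \<omega> > ennreal t}"
      using AE_regular_holding_time AE_space
    proof eventually_elim
      case (elim \<omega>)
      thus ?case by (auto simp: hitting_time_gt_iff[OF elim(1) t] S_def V_def)
    qed
    show "(\<Union>n. ?S n) \<in> sets (chain_space P \<mu>)" using S by auto
  qed measurable
  ultimately show ?thesis using S_law unfolding chain_prob_def by simp
qed

section \<open>Tail integrals and reachability\<close>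

text \<open>
  Each value \<open>f x\<close> is the length of the set of \<open>t \<ge> 0\<close> below it; exchange the two integrals.
\<close>
lemma nn_integral_layer_cake:
  assumes "sigma_finite_measure M" and f[measurable]: "f \<in> borel_measurable M"
  shows "(\<integral>\<^sup>+ x. f x \<partial>M) =
    (\<integral>\<^sup>+ t. indicator {0..} t * emeasure M {x \<in> space M. ennreal t < f x} \<partial>lborel)"
proof -
  interpret sigma_finite_measure M by fact
  interpret pair_sigma_finite M "lborel :: real measure" ..
  have "f x = (\<integral>\<^sup>+ t. indicator {t. 0 \<le> t \<and> ennreal t < f x} t \<partial>lborel)" for x
  proof (cases "f x")
    case (real r)
    hence "{t. 0 \<le> t \<and> ennreal t < f x} = {0..<r}" by (auto simp: ennreal_less_iff)
    thus ?thesis using real by simp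
  next
    case top
    hence "{t. 0 \<le> t \<and> ennreal t < f x} = {0..}" by auto
    moreover have "emeasure lborel {0::real..} = \<infinity>"
    proof -
      have "ennreal (real n) \<le> emeasure lborel {0::real..}" for n
        using emeasure_mono[of "{0..real n}" "{0::real..}" lborel] by auto
      thus ?thesis by (metis ennreal_of_nat_eq_real_of_nat infinity_ennreal_def linorder_not_less
            ennreal_Ex_less_of_nat less_top)
    qed
    ultimately show ?thesis using top by simp
  qed
  hence "(\<integral>\<^sup>+ x. f x \<partial>M) = (\<integral>\<^sup>+ x. \<integral>\<^sup>+ t. indicator {t. 0 \<le> t \<and> ennreal t < f x} t \<partial>lborel \<partial>M)"
    by (rule nn_integral_cong)
  also have "\<dots> = (\<integral>\<^sup>+ t. \<integral>\<^sup>+ x. indicator {t. 0 \<le> t \<and> ennreal t < f x} t \<partial>M \<partial>lborel)"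
  proof (rule Fubini'[symmetric])
    have "(\<lambda>(x, t). indicator {p \<in> space (M \<Otimes>\<^sub>M lborel). 0 \<le> snd p \<and> ennreal (snd p) < f (fst p)} (x, t) :: ennreal)
        \<in> borel_measurable (M \<Otimes>\<^sub>M lborel)" by measurable
    moreover have "(\<lambda>(x, t). indicator {p \<in> space (M \<Otimes>\<^sub>M lborel). 0 \<le> snd p \<and> ennreal (snd p) < f (fst p)} (x, t) :: ennreal) p =
       (\<lambda>(x, t). indicator {t. 0 \<le> t \<and> ennreal t < f x} t) p"
      if "p \<in> space (M \<Otimes>\<^sub>M lborel)" for p :: "'a \<times> real"
      using that by (cases p) (auto simp: indicator_def)
    ultimately show "(\<lambda>(x, t). indicator {t. 0 \<le> t \<and> ennreal t < f x} t :: ennreal)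
        \<in> borel_measurable (M \<Otimes>\<^sub>M lborel)" by (simp cong: measurable_cong)
  qed
  also have "\<dots> = (\<integral>\<^sup>+ t. indicator {0..} t * emeasure M {x \<in> space M. ennreal t < f x} \<partial>lborel)"
  proof (rule nn_integral_cong)
    fix t :: real
    have meas: "{x \<in> space M. ennreal t < f x} \<in> sets M" by measurable
    have "(\<integral>\<^sup>+ x. indicator {t. 0 \<le> t \<and> ennreal t < f x} t \<partial>M) =
        (\<integral>\<^sup>+ x. indicator {0..} t * indicator {x \<in> space M. ennreal t < f x} x \<partial>M)"
      by (intro nn_integral_cong) (auto simp: indicator_def)
    also have "\<dots> = indicator {0..} t * emeasure M {x \<in> space M. ennreal t < f x}"
      using meas by (simp only: nn_integral_cmult borel_measurable_indicator nn_integral_indicator)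
    finally show "(\<integral>\<^sup>+ x. indicator {t. 0 \<le> t \<and> ennreal t < f x} t \<partial>M) =
      indicator {0..} t * emeasure M {x \<in> space M. ennreal t < f x}" .
  qed
  finally show ?thesis .
qed

lemma expected_hitting_time_eq_integral_survival:
  "expected_hitting_time P \<mu> A =
    (\<integral>\<^sup>+ t. indicator {0..} t * ennreal (chain_prob P \<mu> (\<lambda>\<omega>. hitting_time A \<omega> > ennreal t)) \<partial>lborel)"
proof -
  interpret prob_space "chain_space P \<mu>" by (rule prob_space_chain_space)
  show ?thesis
    unfolding expected_hitting_time_def chain_prob_def emeasure_eq_measure[symmetric]
    by (rule nn_integral_layer_cake) (unfold_locales, measurable)
qed

lemma AE_jumps_possible:
  "AE \<omega> in chain_space P \<mu>. \<forall>n. 0 < pmf \<mu> (jump_chain \<omega> 0) *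
     (\<Prod>i<n. pmf (P (jump_chain \<omega> i)) (jump_chain \<omega> (Suc i)))"
proof (subst AE_all_countable, rule allI)
  fix n
  interpret prob_space "chain_space P \<mu>" by (rule prob_space_chain_space)
  let ?w = "\<lambda>x. pmf \<mu> (x 0) * (\<Prod>i<n. pmf (P (x i)) (x (Suc i)))"
  define I where "I = {x \<in> {..n} \<rightarrow>\<^sub>E UNIV. ?w x = 0}"
  let ?E = "\<lambda>x \<omega>. \<forall>i\<le>n. jump_chain \<omega> i = x i"
  have meas: "{\<omega> \<in> space (chain_space P \<mu>). ?E x \<omega>} \<in> sets (chain_space P \<mu>)" for x by measurable
  have "chain_prob P \<mu> (\<lambda>\<omega>. \<exists>x\<in>I. ?E x \<omega>) = (\<Sum>x\<in>I. chain_prob P \<mu> (?E x))"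
  proof (rule sum_finite_path_events[OF _ meas])
    fix x y \<omega> assume xy: "x \<in> I" "y \<in> I" "x \<noteq> y" "?E x \<omega>"
    show "\<not> ?E y \<omega>"
    proof
      assume "?E y \<omega>"
      hence "x i = y i" if "i \<le> n" for i using xy(4) that by metis
      hence "x = y" using PiE_ext[of x "{..n}" "\<lambda>_. UNIV" y] xy(1,2) by (simp add: I_def)
      thus False using xy(3) by simp
    qed
  qed (simp add: I_def finite_PiE)
  also have "\<dots> = 0" by (rule sum.neutral) (simp add: jump_chain_law I_def)
  finally have *: "prob {\<omega> \<in> space (chain_space P \<mu>). \<exists>x\<in>I. ?E x \<omega>} = 0" by (simp add: chain_prob_def)
  have "finite I" by (simp add: I_def finite_PiE)
  hence "{\<omega> \<in> space (chain_space P \<mu>). \<exists>x\<in>I. ?E x \<omega>} \<in> sets (chain_space P \<mu>)"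
    using meas by (intro sets.sets_Collect_finite_Ex) auto
  with * have "AE \<omega> in chain_space P \<mu>. \<omega> \<notin> {\<omega> \<in> space (chain_space P \<mu>). \<exists>x\<in>I. ?E x \<omega>}"
    by (intro AE_not_in) (simp add: null_sets_def emeasure_eq_measure)
  thus "AE \<omega> in chain_space P \<mu>. 0 < ?w (jump_chain \<omega>)"
    using AE_space
  proof eventually_elim
    case (elim \<omega>)
    show ?case
    proof (rule ccontr)
      assume "\<not> 0 < ?w (jump_chain \<omega>)"
      moreover have "0 \<le> ?w (jump_chain \<omega>)" by (intro mult_nonneg_nonneg prod_nonneg) auto
      ultimately have "?w (jump_chain \<omega>) = 0" by linarith
      hence "(\<lambda>i\<in>{..n}. jump_chain \<omega> i) \<in> I" by (auto simp: I_def)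
      thus False using elim by (auto intro!: bexI[of _ "\<lambda>i\<in>{..n}. jump_chain \<omega> i"])
    qed
  qed
qed

text \<open>
  A path of edges inside \<open>B\<close> is followed with positive probability, and then \<open>b2\<close> is reached by the
  start of a holding period that still lies in \<open>B\<close>, strictly before \<open>B\<close> is left. Conversely
  almost every trajectory uses only edges of positive probability, so a single one that reaches \<open>b2\<close>
  before leaving \<open>B\<close> exhibits such a path.
\<close>
theorem reachable_within_iff:
  "(b1, b2) \<in> reachable_within P B \<longleftrightarrow>
     b1 \<in> B \<and> b2 \<in> B \<and> (b1, b2) \<in> {(u, v). u \<in> B \<and> v \<in> B \<and> 0 < pmf (P u) v}\<^sup>*"
    (is "_ \<longleftrightarrow> _ \<and> _ \<and> _ \<in> ?R\<^sup>*")
proof -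
  let ?C = "chain_space P (return_pmf b1)"
  interpret prob_space ?C by (rule prob_space_chain_space)
  let ?hit = "\<lambda>\<omega>. hitting_time {b2} \<omega> < hitting_time (- B) \<omega>"
  have hit_sets: "{\<omega> \<in> space ?C. ?hit \<omega>} \<in> sets ?C" by measurable
  have to_prob: "0 < chain_prob P (return_pmf b1) ?hit" if b: "b1 \<in> B" and path: "(b1, b2) \<in> ?R\<^sup>*"
  proof -
    obtain n where "(b1, b2) \<in> ?R ^^ n" using rtrancl_imp_relpow[OF path] by (elim exE)
    then obtain x where "x 0 = b1 \<and> x n = b2 \<and> (\<forall>i<n. (x i, x (Suc i)) \<in> ?R)"
      unfolding relpow_fun_conv by (elim exE)
    hence x: "x 0 = b1" "x n = b2" "\<And>i. i < n \<Longrightarrow> (x i, x (Suc i)) \<in> ?R" by simp_all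
    have xB: "x i \<in> B" if "i \<le> n" for i
      using that x(3)[of "i - 1"] b x(1) by (cases i) auto
    have "{\<tau> \<in> space clock_space. regular_clock \<tau>} \<in> sets clock_space" by measurable
    hence V: "{\<tau>. regular_clock \<tau>} \<in> sets clock_space" by simp
    have "measure clock_space {\<tau>. regular_clock \<tau>} = 1"
      using AE_regular_clock V
      by (subst prob_space.prob_eq_1[OF prob_space_clock_space]) auto
    hence "chain_prob P (return_pmf b1) (\<lambda>\<omega>. (\<forall>i\<le>n. jump_chain \<omega> i = x i) \<and> holding_time \<omega> \<in> {\<tau>. regular_clock \<tau>})
        = (\<Prod>i<n. pmf (P (x i)) (x (Suc i)))"
      by (subst path_clock_law[OF V]) (simp add: x(1))
    also have "\<dots> > 0" using x(3) by (intro prod_pos) auto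
    finally have "0 < chain_prob P (return_pmf b1)
        (\<lambda>\<omega>. (\<forall>i\<le>n. jump_chain \<omega> i = x i) \<and> holding_time \<omega> \<in> {\<tau>. regular_clock \<tau>})" .
    also have "\<dots> \<le> chain_prob P (return_pmf b1) ?hit"
      unfolding chain_prob_def
    proof (rule finite_measure_mono[OF _ hit_sets], safe)
      fix \<omega> assume \<omega>: "\<forall>i\<le>n. jump_chain \<omega> i = x i" "regular_clock (holding_time \<omega>)"
      let ?a = "arrival (holding_time \<omega>)"
      have mono: "strict_mono ?a" by (rule arrival_strict_mono[OF \<omega>(2)])
      have "hitting_time {b2} \<omega> \<le> ennreal (?a n)"
        using \<omega>(1) x(2) by (intro hitting_time_le_arrival[OF \<omega>(2)]) simp
      also have "\<dots> < ennreal (?a (Suc n))"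
        using strict_monoD[OF mono, of n "Suc n"] strict_mono_less_eq[OF mono, of 0 n]
        by (intro ennreal_lessI) (simp_all add: arrival_def)
      also have "\<dots> \<le> hitting_time (- B) \<omega>"
        using \<omega>(1) xB by (intro arrival_le_hitting_time[OF \<omega>(2)]) (simp add: less_Suc_eq_le)
      finally show "?hit \<omega>" .
    qed
    finally show ?thesis .
  qed
  have to_path: "(b1, b2) \<in> ?R\<^sup>*" if pos: "0 < chain_prob P (return_pmf b1) ?hit"
  proof -
    define good where "good \<omega> \<longleftrightarrow> regular_clock (holding_time \<omega>) \<and>
      (\<forall>n. 0 < pmf (return_pmf b1) (jump_chain \<omega> 0) *
         (\<Prod>i<n. pmf (P (jump_chain \<omega> i)) (jump_chain \<omega> (Suc i))))" for \<omega>
    have AE_good: "AE \<omega> in ?C. good \<omega>"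
      unfolding good_def by (rule AE_conjI[OF AE_regular_holding_time AE_jumps_possible])
    have "\<exists>\<omega>. good \<omega> \<and> ?hit \<omega>"
    proof (rule ccontr)
      assume none: "\<not> (\<exists>\<omega>. good \<omega> \<and> ?hit \<omega>)"
      have "AE \<omega> in ?C. \<omega> \<notin> {\<omega> \<in> space ?C. ?hit \<omega>}"
        by (rule eventually_mono[OF AE_good]) (use none in blast)
      hence "prob {\<omega> \<in> space ?C. ?hit \<omega>} = 0"
        by (rule prob_eq_0[OF hit_sets, THEN iffD2])
      thus False using pos by (simp only: chain_prob_def less_irrefl)
    qed
    then obtain \<omega> where "good \<omega>" and hit: "?hit \<omega>" by (elim exE conjE)
    hence reg: "regular_clock (holding_time \<omega>)"
      and jumps: "\<And>n. 0 < pmf (return_pmf b1) (jump_chain \<omega> 0) *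
         (\<Prod>i<n. pmf (P (jump_chain \<omega> i)) (jump_chain \<omega> (Suc i)))"
      by (simp_all only: good_def)
    let ?a = "arrival (holding_time \<omega>)"
    have start: "jump_chain \<omega> 0 = b1" using jumps[of 0] by (simp add: indicator_def split: if_splits)
    obtain t where t: "0 \<le> t" "chain_at t \<omega> = b2" "ennreal t < hitting_time (- B) \<omega>"
      using hit unfolding hitting_time_def[of "{b2}"] by (auto simp: Inf_less_iff)
    obtain n where n: "?a n \<le> t" "t < ?a (Suc n)" "\<forall>i\<le>n. jump_chain \<omega> i \<notin> - B"
      using t(3) hitting_time_gt_iff[OF reg t(1)] by blast
    have finish: "jump_chain \<omega> n = b2" using chain_at_between_arrivals[OF reg n(1,2)] t(2) by simp
    define y where "y = jump_chain \<omega>"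
    have "(y i, y (Suc i)) \<in> ?R" if "i < n" for i
    proof -
      have "(\<Prod>i<n. pmf (P (y i)) (y (Suc i))) \<noteq> 0"
        using jumps[of n] unfolding y_def[symmetric] by (intro notI) simp
      hence "pmf (P (y i)) (y (Suc i)) \<noteq> 0" using that by auto
      hence "0 < pmf (P (y i)) (y (Suc i))"
        using pmf_nonneg[of "P (y i)" "y (Suc i)"] by linarith
      moreover have "y i \<in> B" "y (Suc i) \<in> B"
        using n(3) that unfolding y_def[symmetric] by auto
      ultimately show ?thesis by simp
    qed
    hence "\<exists>f. f 0 = y 0 \<and> f n = y n \<and> (\<forall>i<n. (f i, f (Suc i)) \<in> ?R)"
      by (intro exI[of _ y] conjI refl allI impI)
    hence "(y 0, y n) \<in> ?R ^^ n" by (simp only: relpow_fun_conv)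
    hence "(b1, b2) \<in> ?R ^^ n" by (simp only: y_def start finish)
    thus ?thesis by (rule relpow_imp_rtrancl)
  qed
  have eq: "(b1, b2) \<in> reachable_within P B \<longleftrightarrow>
      b1 \<in> B \<and> b2 \<in> B \<and> 0 < chain_prob P (return_pmf b1) ?hit"
    by (simp only: reachable_within_def mem_Collect_eq prod.case)
  show ?thesis unfolding eq
    by (intro conj_cong refl iffI) (erule to_path, erule (1) to_prob)
qed

lemma nn_integral_exponential_tail:
  assumes "0 < g" "0 \<le> a"
  shows "(\<integral>\<^sup>+ t. indicator {0..} t * ennreal (a * exp (- (g * t))) \<partial>lborel) = ennreal (a / g)"
proof -
  have "(\<integral>\<^sup>+ t. ennreal (exponential_density g t) \<partial>lborel) = 1"
    using prob_space.emeasure_space_1[OF prob_space_exponential_density[OF assms(1)]]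
    by (simp add: emeasure_density)
  hence "(\<integral>\<^sup>+ t. ennreal (a / g) * ennreal (exponential_density g t) \<partial>lborel) = ennreal (a / g)"
    by (subst nn_integral_cmult) auto
  moreover have "indicator {0..} t * ennreal (a * exp (- (g * t))) =
      ennreal (a / g) * ennreal (exponential_density g t)" for t :: real
    using assms by (simp add: exponential_density_def ennreal_mult[symmetric] indicator_def mult.commute)
  ultimately show ?thesis by simp
qed

lemma chain_prob_hit_le:
  "chain_prob P \<mu> (\<lambda>\<omega>. hitting_time A \<omega> \<le> ennreal t) =
     1 - chain_prob P \<mu> (\<lambda>\<omega>. hitting_time A \<omega> > ennreal t)"
proof -
  interpret prob_space "chain_space P \<mu>" by (rule prob_space_chain_space)
  have "{\<omega> \<in> space (chain_space P \<mu>). hitting_time A \<omega> > ennreal t} \<in> sets (chain_space P \<mu>)" by measurable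
  from prob_compl[OF this]
  have "prob (space (chain_space P \<mu>) - {\<omega> \<in> space (chain_space P \<mu>). hitting_time A \<omega> > ennreal t}) =
      1 - chain_prob P \<mu> (\<lambda>\<omega>. hitting_time A \<omega> > ennreal t)"
    by (simp only: chain_prob_def)
  also have "space (chain_space P \<mu>) - {\<omega> \<in> space (chain_space P \<mu>). hitting_time A \<omega> > ennreal t} =
      {\<omega> \<in> space (chain_space P \<mu>). hitting_time A \<omega> \<le> ennreal t}" by (auto simp: not_less)
  finally show ?thesis by (simp only: chain_prob_def)
qed

section \<open>Irreducible components\<close>

context reversible_chain
begin

text \<open>
  A connected component of \<open>B\<close> in the graph of possible jumps. Connectedness is phrased as an induction
  principle, since positivity of eigenvectors is propagated along edges within \<open>M\<close>.
\<close>
definition inner_component :: "'s set \<Rightarrow> 's set \<Rightarrow> bool" where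
  "inner_component B M \<longleftrightarrow> M \<subseteq> B \<and> M \<noteq> {} \<and>
     (\<forall>x\<in>M. \<forall>y\<in>B. 0 < pmf (P x) y \<longrightarrow> y \<in> M) \<and>
     (\<forall>U. U \<inter> M \<noteq> {} \<longrightarrow> (\<forall>u\<in>U \<inter> M. \<forall>v\<in>M. 0 < pmf (P u) v \<longrightarrow> v \<in> U) \<longrightarrow> M \<subseteq> U)"

lemma edge_symmetric: "0 < pmf (P x) y \<longleftrightarrow> 0 < pmf (P y) x"
proof -
  have "0 < pmf \<pi> x * pmf (P x) y \<longleftrightarrow> 0 < pmf \<pi> y * pmf (P y) x"
    by (simp only: detailed_balance)
  thus ?thesis using stationary_pos[of x] stationary_pos[of y] by (simp add: zero_less_mult_iff)
qed

lemma equiv_reachable_within: "equiv B (reachable_within P B)"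
proof -
  let ?R = "{(u, v). u \<in> B \<and> v \<in> B \<and> 0 < pmf (P u) v}"
  have "sym ?R" using edge_symmetric by (auto simp: sym_def)
  hence s: "sym (?R\<^sup>*)" by (rule sym_rtrancl)
  show ?thesis
  proof (rule equivI)
    show "reachable_within P B \<subseteq> B \<times> B" by (auto simp: reachable_within_iff)
    show "refl_on B (reachable_within P B)" by (rule refl_onI) (auto simp: reachable_within_iff)
    show "sym (reachable_within P B)"
      by (rule symI) (use s in \<open>auto simp: reachable_within_iff dest: symD\<close>)
    show "trans (reachable_within P B)"
      by (rule transI) (auto simp: reachable_within_iff)
  qed
qed

lemma irreducible_component_is_inner:
  assumes "M \<in> irreducible_components P B"
  shows "inner_component B M"
proof -
  let ?R = "{(u, v). u \<in> B \<and> v \<in> B \<and> 0 < pmf (P u) v}"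
  obtain x where x: "x \<in> B" and M: "M = reachable_within P B `` {x}"
    using assms by (auto simp: irreducible_components_def quotient_def)
  have M_iff: "y \<in> M \<longleftrightarrow> y \<in> B \<and> (x, y) \<in> ?R\<^sup>*" for y
    using x by (auto simp: M reachable_within_iff)
  have closed: "z \<in> M" if "y \<in> M" "z \<in> B" "0 < pmf (P y) z" for y z
    using that by (auto simp: M_iff intro: rtrancl_into_rtrancl)
  have connected: "M \<subseteq> U" if U: "U \<inter> M \<noteq> {}" "\<forall>u\<in>U \<inter> M. \<forall>v\<in>M. 0 < pmf (P u) v \<longrightarrow> v \<in> U" for U
  proof
    fix y assume y: "y \<in> M"
    obtain u where u: "u \<in> U" "u \<in> M" using U(1) by blast
    have "(x, u) \<in> reachable_within P B" "(x, y) \<in> reachable_within P B" using u y by (auto simp: M)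
    hence "(u, y) \<in> reachable_within P B"
      using equiv_reachable_within[of B] by (meson equivE symD transD)
    hence "(u, y) \<in> ?R\<^sup>*" by (simp add: reachable_within_iff)
    hence "y \<in> U \<inter> M"
      by (induction rule: rtrancl_induct) (use u U(2) closed in auto)
    thus "y \<in> U" by simp
  qed
  have "x \<in> M" using x by (simp add: M_iff)
  thus ?thesis using closed connected unfolding inner_component_def by (auto simp: M_iff)
qed

lemma irreducible_component_covers:
  assumes "x \<in> B"
  obtains M where "M \<in> irreducible_components P B" "x \<in> M"
  using Union_quotient[OF equiv_reachable_within] assms
  unfolding irreducible_components_def by blast

lemma inner_component_edges:
  assumes "inner_component B M" "x \<in> B" "y \<in> B" "0 < pmf (P x) y"
  shows "x \<in> M \<longleftrightarrow> y \<in> M"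
  using assms edge_symmetric[of x y] unfolding inner_component_def by blast

text \<open>
  No edge joins a component to the rest of \<open>B\<close>, so the restricted matrix is block diagonal: cutting a
  function down to a component commutes with it, and a function living on a component does not
  notice the rest of \<open>B\<close>.
\<close>
lemma component_restriction:
  assumes M: "inner_component B M" and v: "v \<in> supported_on B"
  shows "K M *v (\<chi> x. if x \<in> M then v $ x else 0) = (\<chi> x. if x \<in> M then (K B *v v) $ x else 0)"
proof -
  have MB: "M \<subseteq> B" using M by (simp add: inner_component_def)
  have "(\<Sum>y\<in>M. pmf (P x) y * v $ y) = (\<Sum>y\<in>B. pmf (P x) y * v $ y)" if "x \<in> M" for x
  proof (rule sum.mono_neutral_left)
    show "\<forall>y\<in>B - M. pmf (P x) y * v $ y = 0"
    proof
      fix y assume y: "y \<in> B - M"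
      have "\<not> 0 < pmf (P x) y" using inner_component_edges[OF M, of x y] that MB y by auto
      hence "pmf (P x) y = 0" using pmf_nonneg[of "P x" y] by linarith
      thus "pmf (P x) y * v $ y = 0" by simp
    qed
  qed (use MB in auto)
  thus ?thesis using MB by (auto simp: vec_eq_iff restricted_matrix_mult)
qed

lemma component_extension:
  assumes M: "inner_component B M" and v: "v \<in> supported_on M"
  shows "K B *v v = K M *v v"
proof -
  have MB: "M \<subseteq> B" using M by (simp add: inner_component_def)
  have "(\<Sum>y\<in>B. pmf (P x) y * v $ y) = (if x \<in> M then \<Sum>y\<in>M. pmf (P x) y * v $ y else 0)" if "x \<in> B" for x
  proof (cases "x \<in> M")
    case True
    thus ?thesis using MB v by (auto simp: supported_on_def intro!: sum.mono_neutral_right)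
  next
    case False
    have "pmf (P x) y * v $ y = 0" if y: "y \<in> B" for y
    proof (cases "y \<in> M")
      case True
      hence "\<not> 0 < pmf (P x) y" using inner_component_edges[OF M \<open>x \<in> B\<close> y] False by auto
      hence "pmf (P x) y = 0" using pmf_nonneg[of "P x" y] by linarith
      thus ?thesis by simp
    qed (use v in \<open>simp add: supported_on_def\<close>)
    hence "(\<Sum>y\<in>B. pmf (P x) y * v $ y) = 0" by (intro sum.neutral) blast
    thus ?thesis using False by simp
  qed
  thus ?thesis using MB by (auto simp: vec_eq_iff restricted_matrix_mult)
qed

section \<open>Perron-Frobenius theory for reversible matrices\<close>

text \<open>
  If \<open>v\<close> is positive at \<open>u\<close> and \<open>w\<close> is a neighbour of \<open>u\<close> in \<open>M\<close>, then \<open>l\<close> times the value at \<open>w\<close> is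
  a sum of nonnegative terms, one of which is positive. So positivity spreads through the component.
\<close>
lemma nonneg_eigenvector_positive:
  assumes M: "inner_component B M" and v: "v \<in> supported_on M" "\<And>x. 0 \<le> v $ x" "v \<noteq> 0"
    and eig: "K M *v v = l *\<^sub>R v" and x: "x \<in> M"
  shows "0 < v $ x"
proof -
  have "M \<subseteq> {x. 0 < v $ x}"
  proof (rule M[unfolded inner_component_def, THEN conjunct2, THEN conjunct2, THEN conjunct2, rule_format])
    obtain z where z: "v $ z \<noteq> 0" using v(3) by (auto simp: vec_eq_iff)
    hence "z \<in> M" "0 < v $ z" using v(1) v(2)[of z] by (auto simp: supported_on_def)
    thus "{x. 0 < v $ x} \<inter> M \<noteq> {}" by auto
    fix u w assume u: "u \<in> {x. 0 < v $ x} \<inter> M" and w: "w \<in> M" "0 < pmf (P u) w"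
    have "0 < pmf (P w) u * v $ u" using u w edge_symmetric by auto
    also have "\<dots> \<le> (\<Sum>y\<in>M. pmf (P w) y * v $ y)"
      using u v(2) by (intro member_le_sum) auto
    also have "\<dots> = (K M *v v) $ w" using w by (simp add: restricted_matrix_mult)
    also have "\<dots> = l * v $ w" by (simp add: eig)
    finally have "v $ w \<noteq> 0" by auto
    thus "w \<in> {x. 0 < v $ x}" using v(2)[of w] by simp
  qed
  thus ?thesis using x by auto
qed

text \<open>
  Subtract from \<open>w\<close> the largest multiple of \<open>v\<close> that keeps the difference nonnegative. The difference
  is an eigenvector with a zero in \<open>M\<close>, and thus vanishes by strict positivity.
\<close>
lemma nonneg_eigenvector_unique:
  assumes M: "inner_component B M"
    and v: "v \<in> supported_on M" "\<And>x. 0 \<le> v $ x" "v \<noteq> 0" "K M *v v = l *\<^sub>R v"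
    and w: "w \<in> supported_on M" "\<And>x. 0 \<le> w $ x" "w \<noteq> 0" "K M *v w = l *\<^sub>R w"
  obtains a where "w = a *\<^sub>R v"
proof -
  have vpos: "0 < v $ x" if "x \<in> M" for x by (rule nonneg_eigenvector_positive[OF M v that])
  have ne: "M \<noteq> {}" using M by (simp add: inner_component_def)
  define a where "a = Min ((\<lambda>x. w $ x / v $ x) ` M)"
  have "a \<in> (\<lambda>x. w $ x / v $ x) ` M" unfolding a_def using ne by (intro Min_in) auto
  then obtain x0 where x0: "x0 \<in> M" "a = w $ x0 / v $ x0" by auto
  have a_le: "a \<le> w $ x / v $ x" if "x \<in> M" for x
    unfolding a_def using that by (intro Min_le) auto
  define d where "d = w - a *\<^sub>R v"
  have "d = 0"
  proof (rule ccontr)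
    assume "d \<noteq> 0"
    have "0 < d $ x0"
    proof (rule nonneg_eigenvector_positive[OF M _ _ \<open>d \<noteq> 0\<close> _ x0(1)])
      show "d \<in> supported_on M" unfolding d_def
        by (intro subspace_diff subspace_scale subspace_supported_on v w)
      show "0 \<le> d $ x" for x
      proof (cases "x \<in> M")
        case True
        thus ?thesis using a_le[OF True] vpos[OF True] by (simp add: d_def pos_le_divide_eq)
      qed (use v(1) w(1) in \<open>simp add: d_def supported_on_def\<close>)
      show "K M *v d = l *\<^sub>R d"
        by (simp add: d_def matrix_vector_mult_diff_distrib matrix_vector_mult_scaleR v(4) w(4)
            algebra_simps)
    qed
    thus False using x0 vpos[OF x0(1)] by (simp add: d_def)
  qed
  thus thesis by (intro that[of a]) (simp add: d_def)
qed

lemma quadratic_form_abs_le: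
  shows "\<bar>inn (K B *v v) v\<bar> \<le> inn (K B *v (\<chi> x. \<bar>v $ x\<bar>)) (\<chi> x. \<bar>v $ x\<bar>)"
proof -
  have "\<bar>inn (K B *v v) v\<bar> \<le> (\<Sum>x\<in>UNIV. \<bar>pmf \<pi> x * (K B *v v) $ x * v $ x\<bar>)"
    unfolding weighted_inner_def by (rule sum_abs)
  also have "\<dots> \<le> inn (K B *v (\<chi> x. \<bar>v $ x\<bar>)) (\<chi> x. \<bar>v $ x\<bar>)"
    unfolding weighted_inner_def
  proof (rule sum_mono)
    fix x
    have "\<bar>(K B *v v) $ x\<bar> \<le> (K B *v (\<chi> x. \<bar>v $ x\<bar>)) $ x"
    proof (cases "x \<in> B")
      case True
      have "\<bar>\<Sum>y\<in>B. pmf (P x) y * v $ y\<bar> \<le> (\<Sum>y\<in>B. \<bar>pmf (P x) y * v $ y\<bar>)" by (rule sum_abs)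
      thus ?thesis using True by (simp add: restricted_matrix_mult abs_mult)
    qed (simp add: restricted_matrix_mult)
    thus "\<bar>pmf \<pi> x * (K B *v v) $ x * v $ x\<bar> \<le>
      pmf \<pi> x * (K B *v (\<chi> x. \<bar>v $ x\<bar>)) $ x * (\<chi> x. \<bar>v $ x\<bar>) $ x"
      by (simp add: abs_mult mult.assoc mult_left_mono mult_right_mono)
  qed
  finally show ?thesis .
qed

lemma inn_abs: "inn (\<chi> x. \<bar>v $ x\<bar>) (\<chi> x. \<bar>v $ x\<bar>) = inn v v"
  by (simp add: weighted_inner_def mult.assoc)

text \<open>
  The matrix has nonnegative entries, so taking absolute values does not lower its quadratic form.
  The absolute value of a top eigenvector therefore also maximises the Rayleigh quotient, and all its
  coefficients along smaller eigenvalues vanish. The same comparison bounds the modulus of the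
  negative eigenvalues.
\<close>
lemma top_eigenvector_nonneg:
  assumes "M \<noteq> {}"
  obtains v C lam l where "eigenbasis M C lam" "v \<in> supported_on M" "\<And>x. 0 \<le> v $ x" "v \<noteq> 0"
    "K M *v v = l *\<^sub>R v" "\<And>c. c \<in> C \<Longrightarrow> \<bar>lam c\<bar> \<le> l" "0 \<le> l"
proof -
  obtain C lam where basis: "eigenbasis M C lam" using eigenbasis_exists by blast
  have "C \<noteq> {}"
  proof
    assume "C = {}"
    obtain m where "m \<in> M" using assms by blast
    thus False using basis_expand_component[OF basis indicator_vec_supported, of m] \<open>C = {}\<close>
      by (simp add: indicator_vec_def)
  qed
  have "finite C" by (rule basis_finite[OF basis])
  define l where "l = Max (lam ` C)"
  have le: "lam c \<le> l" if "c \<in> C" for c unfolding l_def using that \<open>finite C\<close> by (intro Max_ge) auto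
  have "l \<in> lam ` C" unfolding l_def using \<open>finite C\<close> \<open>C \<noteq> {}\<close> by (intro Max_in) auto
  then obtain c0 where c0: "c0 \<in> C" "lam c0 = l" by auto
  let ?abs = "\<lambda>w::real^'s. (\<chi> x. \<bar>w $ x\<bar>)"
  have abs_supp: "?abs c \<in> supported_on M" if "c \<in> C" for c
    using basis_supported[OF basis that] by (simp add: supported_on_def)
  have qf_le: "inn (K M *v w) w \<le> l * inn w w" if w: "w \<in> supported_on M" for w
  proof -
    have "(\<Sum>c\<in>C. lam c * (inn w c)\<^sup>2) \<le> (\<Sum>c\<in>C. l * (inn w c)\<^sup>2)"
      using le by (intro sum_mono mult_right_mono) auto
    also have "\<dots> = l * inn w w"
      by (subst parseval[OF basis w, of w]) (simp add: sum_distrib_left power2_eq_square)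
    finally show ?thesis by (simp add: quadratic_form[OF basis w])
  qed
  define v where "v = ?abs c0"
  have v: "v \<in> supported_on M" using abs_supp[OF c0(1)] by (simp add: v_def)
  have vv: "inn v v = 1" using basis_orthonormal[OF basis c0(1) c0(1)] by (simp add: v_def inn_abs)
  have "l \<le> inn (K M *v v) v"
    using quadratic_form_abs_le[of M c0] basis_orthonormal[OF basis c0(1) c0(1)]
    by (simp add: v_def basis_eigen[OF basis c0(1)] weighted_inner_scaleR_left c0(2))
  hence eq: "(\<Sum>c\<in>C. (l - lam c) * (inn v c)\<^sup>2) = 0"
  proof -
    have "(\<Sum>c\<in>C. (l - lam c) * (inn v c)\<^sup>2) = l * inn v v - inn (K M *v v) v"
      unfolding quadratic_form[OF basis v]
      by (subst parseval[OF basis v, of v])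
        (simp add: sum_distrib_left power2_eq_square sum_subtractf algebra_simps)
    also have "\<dots> \<le> 0" using \<open>l \<le> inn (K M *v v) v\<close> vv by simp
    finally show ?thesis using le by (intro antisym sum_nonneg) auto
  qed
  have zero: "(l - lam c) * (inn v c)\<^sup>2 = 0" if "c \<in> C" for c
    using eq that \<open>finite C\<close> le by (subst (asm) sum_nonneg_eq_0_iff) auto
  have coeff: "lam c * inn v c = l * inn v c" if "c \<in> C" for c using zero[OF that] by auto
  have eig: "K M *v v = l *\<^sub>R v"
  proof -
    have "K M *v v = (\<Sum>c\<in>C. inn (K M *v v) c *\<^sub>R c)"
      by (rule basis_expand[OF basis restricted_matrix_mult_supported])
    also have "\<dots> = (\<Sum>c\<in>C. l *\<^sub>R inn v c *\<^sub>R c)"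
      by (intro sum.cong) (simp_all add: restricted_inner_basis[OF basis] coeff)
    also have "\<dots> = l *\<^sub>R (\<Sum>c\<in>C. inn v c *\<^sub>R c)" by (simp add: scaleR_right.sum)
    also have "(\<Sum>c\<in>C. inn v c *\<^sub>R c) = v" by (rule basis_expand[OF basis v, symmetric])
    finally show ?thesis .
  qed
  have abs_le: "\<bar>lam c\<bar> \<le> l" if c: "c \<in> C" for c
  proof -
    have "\<bar>lam c\<bar> = \<bar>inn (K M *v c) c\<bar>"
      using basis_orthonormal[OF basis c c] by (simp add: basis_eigen[OF basis c] weighted_inner_scaleR_left)
    also have "\<dots> \<le> l * inn (?abs c) (?abs c)"
      using quadratic_form_abs_le[of M c] qf_le[OF abs_supp[OF c]] by linarith
    finally show ?thesis using basis_orthonormal[OF basis c c] by (simp add: inn_abs)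
  qed
  show thesis
    by (rule that[OF basis v _ _ eig abs_le]) (use vv abs_le[OF c0(1)] in \<open>auto simp: v_def\<close>)
qed

lemma restricted_detailed_balance: "pmf \<pi> x * K M $ x $ y = pmf \<pi> y * K M $ y $ x"
  by (simp add: restricted_matrix_def detailed_balance)

text \<open>
  The spectral radius is defined through complex eigenvalues; self-adjointness shows that they are
  real. A complex eigenvector whose eigenvalue is neither 0 nor one of the \<open>lam c\<close> vanishes outside
  \<open>M\<close> and is orthogonal to every basis vector, and so are its real and imaginary parts. The value 0 is
  set apart because functions supported outside \<open>M\<close> belong to the kernel.
\<close>
lemma complex_eigenvalues_restricted:
  assumes basis: "eigenbasis M C lam"
  shows "eigenvalues (map_matrix complex_of_real (K M)) \<subseteq> insert 0 (complex_of_real ` lam ` C)"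
proof
  fix z assume "z \<in> eigenvalues (map_matrix complex_of_real (K M))"
  then obtain v where v: "v \<noteq> 0" "map_matrix complex_of_real (K M) *v v = z *s v"
    by (auto simp: eigenvalues_def)
  have comp: "z * v $ x = (\<Sum>y\<in>UNIV. complex_of_real (K M $ x $ y) * v $ y)" for x
    using arg_cong[OF v(2), of "\<lambda>w. w $ x"] by (simp add: matrix_vector_mult_def map_matrix_def)
  show "z \<in> insert 0 (complex_of_real ` lam ` C)"
  proof (rule ccontr)
    assume z: "z \<notin> insert 0 (complex_of_real ` lam ` C)"
    have outside: "v $ x = 0" if "x \<notin> M" for x
      using comp[of x] that z by (simp add: restricted_matrix_def)
    have coeff: "(\<Sum>x\<in>UNIV. complex_of_real (pmf \<pi> x * c $ x) * v $ x) = 0" if c: "c \<in> C" for c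
    proof -
      let ?s = "\<Sum>x\<in>UNIV. complex_of_real (pmf \<pi> x * c $ x) * v $ x"
      have "z * ?s = (\<Sum>x\<in>UNIV. complex_of_real (pmf \<pi> x * c $ x) * (z * v $ x))"
        by (simp add: sum_distrib_left mult_ac)
      also have "\<dots> = (\<Sum>x\<in>UNIV. \<Sum>y\<in>UNIV. complex_of_real (pmf \<pi> x * K M $ x $ y * c $ x) * v $ y)"
        by (simp add: comp sum_distrib_left mult_ac)
      also have "\<dots> = (\<Sum>y\<in>UNIV. \<Sum>x\<in>UNIV. complex_of_real (pmf \<pi> x * K M $ x $ y * c $ x) * v $ y)"
        by (rule sum.swap)
      also have "\<dots> = (\<Sum>y\<in>UNIV. \<Sum>x\<in>UNIV. complex_of_real (pmf \<pi> y * K M $ y $ x * c $ x) * v $ y)"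
        by (intro sum.cong refl arg_cong2[where f = "(*)"] arg_cong[where f = complex_of_real]
            restricted_detailed_balance)
      also have "\<dots> = (\<Sum>y\<in>UNIV. complex_of_real (pmf \<pi> y * (K M *v c) $ y) * v $ y)"
        by (simp add: matrix_vector_mult_def sum_distrib_left sum_distrib_right mult_ac)
      also have "\<dots> = complex_of_real (lam c) * ?s"
        by (simp add: basis_eigen[OF basis c] sum_distrib_left mult_ac)
      finally have "(z - complex_of_real (lam c)) * ?s = 0" by (simp add: algebra_simps)
      thus ?thesis using z c by auto
    qed
    define re im where "re = (\<chi> x. Re (v $ x))" and "im = (\<chi> x. Im (v $ x))"
    have supp: "re \<in> supported_on M" "im \<in> supported_on M"
      using outside by (auto simp: re_def im_def supported_on_def)
    have "inn re c = 0" "inn im c = 0" if "c \<in> C" for c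
      using arg_cong[OF coeff[OF that], of Re] arg_cong[OF coeff[OF that], of Im]
      by (simp_all add: weighted_inner_def re_def im_def mult_ac)
    hence "re = 0" "im = 0"
      using basis_expand[OF basis supp(1)] basis_expand[OF basis supp(2)] by simp_all
    hence "v = 0" by (simp add: re_def im_def vec_eq_iff complex_eq_iff)
    thus False using v(1) by simp
  qed
qed

theorem perron_frobenius:
  assumes "M \<noteq> {}"
  obtains v where "v \<in> supported_on M" "\<And>x. 0 \<le> v $ x" "v \<noteq> 0"
    "K M *v v = spectral_radius (K M) *\<^sub>R v"
    "\<And>w l. w \<in> supported_on M \<Longrightarrow> w \<noteq> 0 \<Longrightarrow> K M *v w = l *\<^sub>R w \<Longrightarrow> l \<le> spectral_radius (K M)"
proof -
  obtain v C lam l where basis: "eigenbasis M C lam"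
    and v: "v \<in> supported_on M" "\<And>x. 0 \<le> v $ x" "v \<noteq> 0" "K M *v v = l *\<^sub>R v"
    and le: "\<And>c. c \<in> C \<Longrightarrow> \<bar>lam c\<bar> \<le> l" "0 \<le> l"
    using top_eigenvector_nonneg[OF assms] by metis
  let ?E = "eigenvalues (map_matrix complex_of_real (K M))"
  have sub: "?E \<subseteq> insert 0 (complex_of_real ` lam ` C)" by (rule complex_eigenvalues_restricted[OF basis])
  have "spectral_radius (K M) = l"
    unfolding spectral_radius_def
  proof (rule Max_eqI)
    show "finite (cmod ` ?E)"
      using sub basis_finite[OF basis] by (intro finite_imageI) (rule finite_subset, auto)
    show "y \<le> l" if "y \<in> cmod ` ?E" for y using that sub le by force
    have "complex_of_real l \<in> ?E"
    proof -
      let ?v = "\<chi> x. complex_of_real (v $ x)"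
      have "?v \<noteq> 0" using v(3) by (auto simp: vec_eq_iff)
      moreover have "map_matrix complex_of_real (K M) *v ?v = complex_of_real l *s ?v"
      proof (subst vec_eq_iff, rule allI)
        fix x
        have "(K M *v v) $ x = l * v $ x" by (simp add: v(4))
        hence "complex_of_real ((K M *v v) $ x) = complex_of_real (l * v $ x)" by (rule arg_cong)
        thus "(map_matrix complex_of_real (K M) *v ?v) $ x = (complex_of_real l *s ?v) $ x"
          by (simp add: matrix_vector_mult_def map_matrix_def)
      qed
      ultimately show ?thesis unfolding eigenvalues_def by blast
    qed
    thus "l \<in> cmod ` ?E" using le(2) by (intro image_eqI[of _ _ "complex_of_real l"]) auto
  qed
  moreover have "l' \<le> l" if "w \<in> supported_on M" "w \<noteq> 0" "K M *v w = l' *\<^sub>R w" for w l'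
    using eigenvalue_in_basis[OF basis that] le(1) by fastforce
  ultimately show thesis using that v by metis
qed

section \<open>Quasi-stationary distributions\<close>

lemma left_eigenvector_iff:
  assumes "\<And>x. pmf \<alpha> x = pmf \<pi> x * v $ x"
  shows "(\<chi> x. pmf \<alpha> x) v* K M = l *s (\<chi> x. pmf \<alpha> x) \<longleftrightarrow> K M *v v = l *\<^sub>R v"
proof -
  have "((\<chi> x. pmf \<alpha> x) v* K M) $ y = pmf \<pi> y * (K M *v v) $ y" for y
  proof -
    have "((\<chi> x. pmf \<alpha> x) v* K M) $ y = (\<Sum>x\<in>UNIV. pmf \<pi> x * K M $ x $ y * v $ x)"
      by (simp add: vector_matrix_mult_def assms mult_ac)
    also have "\<dots> = (\<Sum>x\<in>UNIV. pmf \<pi> y * K M $ y $ x * v $ x)"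
      by (intro sum.cong refl) (auto simp: restricted_matrix_def detailed_balance)
    finally show ?thesis by (simp add: matrix_vector_mult_def sum_distrib_left mult_ac)
  qed
  moreover have "pmf \<pi> y \<noteq> 0" for y using stationary_pos[of y] by simp
  ultimately show ?thesis by (simp add: vec_eq_iff assms mult.left_commute[of l])
qed

text \<open>
  By detailed balance, probability vectors that are left eigenvectors correspond to nonnegative
  right eigenvectors, multiplied by \<open>\<pi>\<close>. Perron-Frobenius theory gives exactly one after
  normalisation, so the definite description denotes it.
\<close>
theorem quasi_stationary_density:
  assumes M: "inner_component B M"
  obtains v where "v \<in> supported_on M" "v \<noteq> 0"
    "K M *v v = spectral_radius (K M) *\<^sub>R v"
    "\<And>x. pmf (quasi_stationary P M) x = pmf \<pi> x * v $ x"
proof -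
  let ?r = "spectral_radius (K M)"
  have "M \<noteq> {}" using M by (simp add: inner_component_def)
  then obtain u where u: "u \<in> supported_on M" "\<And>x. 0 \<le> u $ x" "u \<noteq> 0" "K M *v u = ?r *\<^sub>R u"
    by (rule perron_frobenius) metis
  define Z where "Z = (\<Sum>x\<in>UNIV. pmf \<pi> x * u $ x)"
  have Z: "0 < Z"
  proof -
    obtain x where "u $ x \<noteq> 0" using u(3) by (auto simp: vec_eq_iff)
    hence "0 < pmf \<pi> x * u $ x" using stationary_pos[of x] u(2)[of x] by simp
    also have "\<dots> \<le> Z" unfolding Z_def using u(2) by (intro member_le_sum) auto
    finally show ?thesis .
  qed
  define v where "v = (1 / Z) *\<^sub>R u"
  have v: "v \<in> supported_on M" "\<And>x. 0 \<le> v $ x" "v \<noteq> 0" "K M *v v = ?r *\<^sub>R v"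
    using u Z by (auto simp: v_def subspace_scale[OF subspace_supported_on] matrix_vector_mult_scaleR)
  have total: "(\<Sum>x\<in>UNIV. pmf \<pi> x * v $ x) = 1"
    using Z by (simp add: v_def sum_divide_distrib[symmetric] Z_def[symmetric])
  define \<alpha> where "\<alpha> = embed_pmf (\<lambda>x. pmf \<pi> x * v $ x)"
  have \<alpha>: "pmf \<alpha> x = pmf \<pi> x * v $ x" for x
    unfolding \<alpha>_def
  proof (rule pmf_embed_pmf)
    show "0 \<le> pmf \<pi> x * v $ x" for x using v(2) by simp
    show "(\<integral>\<^sup>+ x. ennreal (pmf \<pi> x * v $ x) \<partial>count_space UNIV) = 1"
      using total v(2) by (simp add: nn_integral_count_space_finite sum_ennreal)
  qed
  have "quasi_stationary P M = \<alpha>"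
    unfolding quasi_stationary_def
  proof (rule the_equality)
    have "set_pmf \<alpha> \<subseteq> M" using v(1) by (auto simp: set_pmf_iff \<alpha> supported_on_def)
    thus "set_pmf \<alpha> \<subseteq> M \<and> (\<chi> x. pmf \<alpha> x) v* K M = ?r *s (\<chi> x. pmf \<alpha> x)"
      using left_eigenvector_iff[of \<alpha> v, OF \<alpha>] v(4) by simp
    fix \<beta> assume \<beta>: "set_pmf \<beta> \<subseteq> M \<and> (\<chi> x. pmf \<beta> x) v* K M = ?r *s (\<chi> x. pmf \<beta> x)"
    define w where "w = (\<chi> x. pmf \<beta> x / pmf \<pi> x)"
    have pos: "pmf \<pi> x \<noteq> 0" for x using stationary_pos[of x] by simp
    have \<beta>w: "pmf \<beta> x = pmf \<pi> x * w $ x" for x using pos by (simp add: w_def)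
    have w: "w \<in> supported_on M" "\<And>x. 0 \<le> w $ x" "K M *v w = ?r *\<^sub>R w"
    proof -
      show "w \<in> supported_on M" using \<beta> by (auto simp: supported_on_def w_def set_pmf_iff)
      show "0 \<le> w $ x" for x by (simp add: w_def)
      show "K M *v w = ?r *\<^sub>R w" using left_eigenvector_iff[of \<beta> w, OF \<beta>w] \<beta> by simp
    qed
    have sum_w: "(\<Sum>x\<in>UNIV. pmf \<pi> x * w $ x) = 1" by (simp add: \<beta>w[symmetric] sum_pmf_eq_1)
    hence "w \<noteq> 0" by auto
    then obtain a where a: "w = a *\<^sub>R v"
      using nonneg_eigenvector_unique[OF M v w(1,2) _ w(3)] by blast
    have "a = 1" using sum_w total by (simp add: a mult.left_commute[of _ a] sum_distrib_left[symmetric])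
    thus "\<beta> = \<alpha>" using a by (intro pmf_eqI) (simp add: \<beta>w \<alpha>)
  qed
  thus thesis using that[OF v(1,3,4)] \<alpha> by simp
qed

section \<open>Interlacing with the second eigenvalue\<close>

text \<open>
  The plane spanned by \<open>c\<close> and \<open>d\<close> contains a nonzero vector \<open>h\<close> orthogonal to the constants. Its
  quadratic form is at least \<open>lam d\<close> times its squared norm, as \<open>lam d\<close> is the smaller of the two
  eigenvalues, and at most the second eigenvalue times it. The form does not depend on whether the
  chain is restricted to \<open>B\<close>, because \<open>h\<close> is supported there.
\<close>
lemma restricted_eigenvalue_le_second:
  assumes basis: "eigenbasis B C lam"
    and c: "c \<in> C" and d: "d \<in> C" "c \<noteq> d" "lam d \<le> lam c"
  shows "lam d \<le> second_eigenvalue P"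
proof -
  obtain C' lam' where basis': "eigenbasis UNIV C' lam'" using eigenbasis_exists by blast
  let ?e = "indicator_vec UNIV :: real^'s"
  \<comment> \<open>If \<open>d\<close> itself is orthogonal to the constants, then \<open>h = d\<close>.\<close>
  define p q where "p = inn d ?e"
    and "q = (if inn d ?e = 0 then 1 else - inn c ?e)"
  define h where "h = p *\<^sub>R c + q *\<^sub>R d"
  have pq: "0 < p\<^sup>2 + q\<^sup>2"
    by (cases "inn d ?e = 0") (auto simp: p_def q_def sum_power2_gt_zero_iff)
  have orth: "inn h ?e = 0"
    by (simp add: h_def p_def q_def weighted_inner_add_left weighted_inner_scaleR_left)
  have hc: "inn h c = p" "inn h d = q"
    using basis_orthonormal[OF basis] c d by (simp_all add: h_def weighted_inner_add_left weighted_inner_scaleR_left)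
  have hh: "inn h h = p\<^sup>2 + q\<^sup>2"
    using hc by (simp add: h_def weighted_inner_add_right weighted_inner_scaleR_right power2_eq_square)
  have hB: "h \<in> supported_on B" unfolding h_def
    by (intro subspace_add subspace_scale subspace_supported_on basis_supported[OF basis] c d)
  have "lam d * (p\<^sup>2 + q\<^sup>2) \<le> lam c * p\<^sup>2 + lam d * q\<^sup>2"
    using d(3) by (simp add: distrib_left mult_right_mono)
  also have "\<dots> = inn (K B *v h) h"
  proof -
    have "inn (K B *v h) h = p * inn (K B *v h) c + q * inn (K B *v h) d"
      by (simp add: h_def weighted_inner_add_right weighted_inner_scaleR_right)
    also have "\<dots> = p * (lam c * inn h c) + q * (lam d * inn h d)"
      by (simp add: restricted_inner_basis[OF basis] c d)
    finally show ?thesis by (simp add: hc power2_eq_square)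
  qed
  also have "\<dots> = inn (K UNIV *v h) h"
    unfolding weighted_inner_def
  proof (intro sum.cong refl)
    fix x
    show "pmf \<pi> x * (K B *v h) $ x * h $ x = pmf \<pi> x * (K UNIV *v h) $ x * h $ x"
    proof (cases "x \<in> B")
      case True
      thus ?thesis
        by (simp add: restricted_matrix_mult_of_supported[OF hB] restricted_matrix_UNIV transition_matrix_mult)
    qed (use hB in \<open>simp add: supported_on_def\<close>)
  qed
  also have "\<dots> \<le> second_eigenvalue P * (p\<^sup>2 + q\<^sup>2)"
    using poincare[OF basis' orth] by (simp only: hh)
  finally show ?thesis using pq by (simp add: mult_le_cancel_right)
qed

section \<open>Spectral form of the survival probability\<close>

text \<open>
  The function \<open>exp (- t (I - K))\<close> applied to the indicator of \<open>B\<close>, in the eigenbasis.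
\<close>
definition survival :: "'s set \<Rightarrow> (real^'s) set \<Rightarrow> (real^'s \<Rightarrow> real) \<Rightarrow> real \<Rightarrow> real^'s" where
  "survival B C lam t = (\<Sum>c\<in>C. (exp (- ((1 - lam c) * t)) * inn (indicator_vec B) c) *\<^sub>R c)"

context
  fixes A :: "'s set" and C :: "(real^'s) set" and lam
  assumes basis: "eigenbasis (- A) C lam"
begin

abbreviation ind :: "real^'s" where "ind \<equiv> indicator_vec (- A)"
abbreviation surv :: "real \<Rightarrow> real^'s" where "surv \<equiv> survival (- A) C lam"

text \<open>
  In the eigenbasis, the Poisson mixture of the powers \<open>lam c ^ n\<close> is an exponential series.
\<close>
lemma survival_probability:
  assumes t: "0 \<le> t"
  shows "chain_prob P \<mu> (\<lambda>\<omega>. hitting_time A \<omega> > ennreal t) = (\<Sum>x\<in>UNIV. pmf \<mu> x * surv t $ x)"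
proof -
  let ?m = "\<lambda>c. \<Sum>x\<in>UNIV. pmf \<mu> x * c $ x"
  have pow: "(\<Sum>x\<in>UNIV. pmf \<mu> x * ((((*v) (K (- A))) ^^ n) ind) $ x) =
      (\<Sum>c\<in>C. lam c ^ n * (inn ind c * ?m c))" for n
  proof -
    have "(\<Sum>x\<in>UNIV. pmf \<mu> x * ((((*v) (K (- A))) ^^ n) ind) $ x) =
        (\<Sum>x\<in>UNIV. \<Sum>c\<in>C. pmf \<mu> x * (lam c ^ n * inn ind c * c $ x))"
      by (simp add: funpow_expand[OF basis indicator_vec_supported] sum_distrib_left)
    also have "\<dots> = (\<Sum>c\<in>C. \<Sum>x\<in>UNIV. pmf \<mu> x * (lam c ^ n * inn ind c * c $ x))"
      by (rule sum.swap)
    finally show ?thesis by (simp add: sum_distrib_left mult_ac)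
  qed
  have "(\<lambda>n. t ^ n * exp (- t) / fact n * (lam c ^ n * (inn ind c * ?m c))) sums
      (exp (- ((1 - lam c) * t)) * (inn ind c * ?m c))" for c
  proof -
    have "(\<lambda>n. (lam c * t) ^ n / fact n) sums exp (lam c * t)"
      using exp_converges[of "lam c * t"] by (simp add: divide_inverse mult.commute)
    hence "(\<lambda>n. (lam c * t) ^ n / fact n * (exp (- t) * (inn ind c * ?m c))) sums
        (exp (lam c * t) * (exp (- t) * (inn ind c * ?m c)))" by (rule sums_mult2)
    moreover have "exp (- ((1 - lam c) * t)) = exp (lam c * t) * exp (- t)"
      by (simp add: exp_add[symmetric] algebra_simps)
    ultimately show ?thesis by (simp add: power_mult_distrib mult_ac)
  qed
  hence "(\<lambda>n. \<Sum>c\<in>C. t ^ n * exp (- t) / fact n * (lam c ^ n * (inn ind c * ?m c))) sums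
      (\<Sum>c\<in>C. exp (- ((1 - lam c) * t)) * (inn ind c * ?m c))" by (intro sums_sum)
  moreover have "(\<lambda>n. \<Sum>c\<in>C. t ^ n * exp (- t) / fact n * (lam c ^ n * (inn ind c * ?m c))) sums
      chain_prob P \<mu> (\<lambda>\<omega>. hitting_time A \<omega> > ennreal t)"
    using survival_series[OF t, of \<mu> P A] pow
    by (simp only: indicator_vec_def[symmetric] sum_distrib_left)
  ultimately have "chain_prob P \<mu> (\<lambda>\<omega>. hitting_time A \<omega> > ennreal t) =
      (\<Sum>c\<in>C. exp (- ((1 - lam c) * t)) * (inn ind c * ?m c))" by (rule sums_unique2[symmetric])
  also have "\<dots> = (\<Sum>c\<in>C. \<Sum>x\<in>UNIV. pmf \<mu> x * (exp (- ((1 - lam c) * t)) * inn ind c * c $ x))"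
    by (simp add: sum_distrib_left mult_ac)
  also have "\<dots> = (\<Sum>x\<in>UNIV. pmf \<mu> x * surv t $ x)"
    by (subst sum.swap) (simp add: survival_def sum_distrib_left)
  finally show ?thesis .
qed

lemma survival_supported: "surv t \<in> supported_on (- A)"
  unfolding survival_def
  by (intro subspace_sum subspace_scale subspace_supported_on basis_supported[OF basis])

lemma survival_coefficient:
  assumes "c \<in> C"
  shows "inn (surv t) c = exp (- ((1 - lam c) * t)) * inn ind c"
proof -
  have "inn (surv t) c = (\<Sum>d\<in>C. exp (- ((1 - lam d) * t)) * inn ind d * inn d c)"
    by (simp add: survival_def weighted_inner_sum_left weighted_inner_scaleR_left)
  also have "\<dots> = (\<Sum>d\<in>C. if d = c then exp (- ((1 - lam d) * t)) * inn ind d else 0)"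
    using basis_orthonormal[OF basis _ assms] by (intro sum.cong) auto
  finally show ?thesis using assms basis_finite[OF basis] by simp
qed

lemma survival_from_stationarity:
  assumes "0 \<le> t"
  shows "chain_prob P \<pi> (\<lambda>\<omega>. hitting_time A \<omega> > ennreal t) =
    (\<Sum>c\<in>C. exp (- ((1 - lam c) * t)) * (inn ind c)\<^sup>2)"
proof -
  have "(\<Sum>x\<in>UNIV. pmf \<pi> x * surv t $ x) = inn (surv t) ind"
    unfolding weighted_inner_def using survival_supported[of t]
    by (intro sum.cong) (auto simp: indicator_vec_def indicator_def supported_on_def)
  also have "\<dots> = (\<Sum>c\<in>C. inn (surv t) c * inn ind c)"
    by (rule parseval[OF basis survival_supported])
  finally show ?thesis
    by (simp add: survival_probability[OF assms] survival_coefficient power2_eq_square mult.assoc)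
qed

lemma indicator_coefficients_sum: "(\<Sum>c\<in>C. (inn ind c)\<^sup>2) = 1 - measure_pmf.prob \<pi> A"
proof -
  have "(\<Sum>c\<in>C. (inn ind c)\<^sup>2) = inn ind ind"
    by (subst parseval[OF basis indicator_vec_supported, of ind]) (simp add: power2_eq_square)
  also have "\<dots> = (\<Sum>x\<in>- A. pmf \<pi> x)"
    unfolding weighted_inner_def by (intro sum.mono_neutral_cong_right) (auto simp: indicator_vec_def)
  also have "\<dots> = measure_pmf.prob \<pi> (- A)" by (simp add: measure_measure_pmf_finite)
  also have "\<dots> = 1 - measure_pmf.prob \<pi> A"
    using measure_pmf.prob_compl[of A \<pi>] by (simp add: Compl_eq_Diff_UNIV)
  finally show ?thesis .
qed

lemma component_spectral_radius:
  assumes M: "inner_component (- A) M"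
  shows "spectral_radius (K M) \<in> lam ` C" "A \<noteq> {} \<Longrightarrow> spectral_radius (K M) < 1"
proof -
  obtain v where v: "v \<in> supported_on M" "v \<noteq> 0" "K M *v v = spectral_radius (K M) *\<^sub>R v"
    using quasi_stationary_density[OF M] by metis
  have vA: "v \<in> supported_on (- A)"
    using v(1) M by (auto simp: supported_on_def inner_component_def)
  have eig: "K (- A) *v v = spectral_radius (K M) *\<^sub>R v"
    using component_extension[OF M v(1)] v(3) by simp
  show "spectral_radius (K M) \<in> lam ` C" by (rule eigenvalue_in_basis[OF basis vA v(2) eig])
  show "spectral_radius (K M) < 1" if "A \<noteq> {}"
    by (rule restricted_eigenvalue_lt_1[OF _ vA v(2) eig]) (use that in auto)
qed

text \<open>
  The density of the quasi-stationary distribution is an eigenvector of \<open>K (- A)\<close>, so only modes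
  with its own eigenvalue contribute, and they all decay at the same rate.
\<close>
lemma quasi_stationary_survival:
  assumes M: "inner_component (- A) M" and t: "0 \<le> t"
  shows "chain_prob P (quasi_stationary P M) (\<lambda>\<omega>. hitting_time A \<omega> > ennreal t) =
    exp (- ((1 - spectral_radius (K M)) * t))"
proof -
  let ?r = "spectral_radius (K M)"
  obtain v where v: "v \<in> supported_on M" "K M *v v = ?r *\<^sub>R v"
    "\<And>x. pmf (quasi_stationary P M) x = pmf \<pi> x * v $ x"
    using quasi_stationary_density[OF M] by metis
  have vA: "v \<in> supported_on (- A)"
    using v(1) M by (auto simp: supported_on_def inner_component_def)
  have eig: "K (- A) *v v = ?r *\<^sub>R v" using component_extension[OF M v(1)] v(2) by simp
  have "(\<Sum>x\<in>UNIV. pmf (quasi_stationary P M) x * surv t $ x) = inn v (surv t)"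
    by (simp add: weighted_inner_def v(3))
  also have "\<dots> = (\<Sum>c\<in>C. inn v c * inn (surv t) c)" by (rule parseval[OF basis vA])
  also have "\<dots> = (\<Sum>c\<in>C. exp (- ((1 - ?r) * t)) * (inn v c * inn ind c))"
  proof (rule sum.cong[OF refl])
    fix c assume c: "c \<in> C"
    show "inn v c * inn (surv t) c = exp (- ((1 - ?r) * t)) * (inn v c * inn ind c)"
    proof (cases "lam c = ?r")
      case True
      thus ?thesis by (simp add: survival_coefficient[OF c])
    next
      case False
      thus ?thesis using eigenvector_in_eigenspace[OF basis vA eig c False] by simp
    qed
  qed
  also have "\<dots> = exp (- ((1 - ?r) * t)) * inn v ind"
    by (subst parseval[OF basis vA, of ind]) (simp add: sum_distrib_left)
  also have "inn v ind = (\<Sum>x\<in>UNIV. pmf (quasi_stationary P M) x)"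
    unfolding weighted_inner_def using vA
    by (intro sum.cong) (auto simp: v(3) indicator_vec_def supported_on_def indicator_def)
  also have "\<dots> = 1" by (simp add: sum_pmf_eq_1)
  finally show ?thesis by (simp add: survival_probability[OF t])
qed

lemma quasi_stationary_expected:
  assumes A_ne: "A \<noteq> {}" and M: "inner_component (- A) M"
  shows "expected_hitting_time P (quasi_stationary P M) A = ennreal (1 / (1 - spectral_radius (K M)))"
proof -
  let ?g = "1 - spectral_radius (K M)"
  have g: "0 < ?g" using component_spectral_radius(2)[OF M A_ne] by simp
  have "expected_hitting_time P (quasi_stationary P M) A =
      (\<integral>\<^sup>+ t. indicator {0..} t * ennreal (1 * exp (- (?g * t))) \<partial>lborel)"
    unfolding expected_hitting_time_eq_integral_survival
    by (intro nn_integral_cong) (auto simp: indicator_def quasi_stationary_survival[OF M])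
  also have "\<dots> = ennreal (1 / ?g)" by (rule nn_integral_exponential_tail[OF g]) simp
  finally show ?thesis .
qed

section \<open>The maximal component and the comparison\<close>

text \<open>
  The part of an eigenvector on a component where it does not vanish is an eigenvector there.
\<close>
lemma eigenvalue_le_component:
  assumes c: "c \<in> C"
  obtains M where "M \<in> irreducible_components P (- A)" "lam c \<le> spectral_radius (K M)"
proof -
  obtain x where x: "c $ x \<noteq> 0" using basis_nonzero[OF basis c] by (auto simp: vec_eq_iff)
  have cA: "c \<in> supported_on (- A)" by (rule basis_supported[OF basis c])
  hence "x \<in> - A" using x by (auto simp: supported_on_def)
  then obtain M where M: "M \<in> irreducible_components P (- A)" "x \<in> M"
    by (rule irreducible_component_covers)
  let ?w = "\<chi> x. if x \<in> M then c $ x else 0"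
  have w: "?w \<in> supported_on M" "?w \<noteq> 0" using x M(2) by (auto simp: supported_on_def vec_eq_iff)
  have eig: "K M *v ?w = lam c *\<^sub>R ?w"
    unfolding component_restriction[OF irreducible_component_is_inner[OF M(1)] cA] basis_eigen[OF basis c]
    by (simp add: vec_eq_iff)
  have "M \<noteq> {}" using M(2) by auto
  then obtain "lam c \<le> spectral_radius (K M)"
    by (rule perron_frobenius) (use w eig in metis)
  thus thesis using that M(1) by blast
qed

lemma maximal_component_spectral_radius:
  assumes A_ne: "A \<noteq> {}" and M: "M \<in> irreducible_components P (- A)"
    and maximal: "\<forall>M' \<in> irreducible_components P (- A).
      expected_hitting_time P (quasi_stationary P M') A
        \<le> expected_hitting_time P (quasi_stationary P M) A"
    and c: "c \<in> C"
  shows "lam c \<le> spectral_radius (K M)"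
proof -
  obtain M' where M': "M' \<in> irreducible_components P (- A)" "lam c \<le> spectral_radius (K M')"
    by (rule eigenvalue_le_component[OF c])
  note inner = irreducible_component_is_inner[OF M] irreducible_component_is_inner[OF M'(1)]
  have lt: "spectral_radius (K M) < 1" "spectral_radius (K M') < 1"
    using component_spectral_radius(2)[OF _ A_ne] inner by blast+
  have "ennreal (1 / (1 - spectral_radius (K M'))) \<le> ennreal (1 / (1 - spectral_radius (K M)))"
    using bspec[OF maximal M'(1)]
    by (simp only: quasi_stationary_expected[OF A_ne inner(1)] quasi_stationary_expected[OF A_ne inner(2)])
  hence "1 / (1 - spectral_radius (K M')) \<le> 1 / (1 - spectral_radius (K M))"
    using lt by (simp add: ennreal_le_iff)
  hence "spectral_radius (K M') \<le> spectral_radius (K M)" using lt by (simp add: field_simps)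
  thus ?thesis using M'(2) by simp
qed

text \<open>
  The term \<open>c0\<close> of the squared norm of the hitting probabilities is discarded. For every other \<open>c\<close>,
  interlacing makes the mode decay to at most \<open>exp (- 2) \<le> 1/4\<close> by the time \<open>s\<close>, so it contributes
  at least \<open>(3/4)\<^sup>2 \<ge> 1/2\<close> times the square of its coefficient.
\<close>
lemma hitting_square_bound:
  assumes A: "A \<noteq> {}" "A \<noteq> UNIV"
    and c0: "c0 \<in> C" and max: "\<And>c. c \<in> C \<Longrightarrow> lam c \<le> lam c0"
  shows "1 - (inn ind c0)\<^sup>2 \<le> measure_pmf.prob \<pi> A +
    2 * (\<Sum>x\<in>UNIV. pmf \<pi> x * (chain_prob P (return_pmf x)
            (\<lambda>\<omega>. hitting_time A \<omega> \<le> ennreal (2 * relaxation_time P)))\<^sup>2)"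
proof -
  define s where "s = 2 * relaxation_time P"
  let ?f = "\<lambda>x. chain_prob P (return_pmf x) (\<lambda>\<omega>. hitting_time A \<omega> \<le> ennreal s)"
  obtain C' lam' where basis': "eigenbasis UNIV C' lam'" using eigenbasis_exists by blast
  obtain a b where "a \<in> A" "b \<notin> A" using A by blast
  hence gap: "second_eigenvalue P < 1" by (intro second_eigenvalue_lt_1[OF basis', of a b]) auto
  hence s: "0 \<le> s" "(1 - second_eigenvalue P) * s = 2"
    by (simp_all add: s_def relaxation_time_def field_simps)
  have f: "?f x = 1 - surv s $ x" for x
  proof -
    have "(\<Sum>y\<in>UNIV. pmf (return_pmf x) y * surv s $ y) = (\<Sum>y\<in>UNIV. if y = x then surv s $ y else 0)"
      by (intro sum.cong) (auto simp: indicator_def)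
    thus ?thesis by (simp add: chain_prob_hit_le survival_probability[OF s(1)])
  qed
  have exp2: "exp (- 2) \<le> (1/4 :: real)"
  proof -
    have "(2::real) \<le> exp 1" using exp_ge_add_one_self[of "1::real"] by simp
    hence "2 * 2 \<le> exp (1::real) * exp 1" by (intro mult_mono) auto
    hence "4 \<le> exp (2::real)" by (simp add: exp_add[symmetric])
    thus ?thesis by (simp add: exp_minus field_simps)
  qed
  have decay: "exp (- ((1 - lam c) * s)) \<le> 1/4" if c: "c \<in> C" "c \<noteq> c0" for c
  proof -
    have "lam c \<le> second_eigenvalue P"
      by (rule restricted_eigenvalue_le_second[OF basis c0 c(1) _ max[OF c(1)]])
        (use c in auto)
    hence "(1 - second_eigenvalue P) * s \<le> (1 - lam c) * s" using s(1) by (intro mult_right_mono) auto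
    hence "exp (- ((1 - lam c) * s)) \<le> exp (- 2)" using s(2) by simp
    thus ?thesis using exp2 by linarith
  qed
  have "(1 - measure_pmf.prob \<pi> A) - (inn ind c0)\<^sup>2 = (\<Sum>c\<in>C - {c0}. (inn ind c)\<^sup>2)"
    using c0 basis_finite[OF basis] by (simp add: indicator_coefficients_sum[symmetric] sum_diff1)
  also have "\<dots> \<le> (\<Sum>c\<in>C - {c0}. 2 * ((1 - exp (- ((1 - lam c) * s))) * inn ind c)\<^sup>2)"
  proof (rule sum_mono)
    fix c assume "c \<in> C - {c0}"
    hence "3/4 \<le> 1 - exp (- ((1 - lam c) * s))" using decay[of c] by simp
    hence "(3/4)\<^sup>2 \<le> (1 - exp (- ((1 - lam c) * s)))\<^sup>2" by (intro power_mono) auto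
    hence "1 \<le> 2 * (1 - exp (- ((1 - lam c) * s)))\<^sup>2" by (simp add: power2_eq_square)
    hence "1 * (inn ind c)\<^sup>2 \<le> 2 * (1 - exp (- ((1 - lam c) * s)))\<^sup>2 * (inn ind c)\<^sup>2"
      by (intro mult_right_mono) auto
    thus "(inn ind c)\<^sup>2 \<le> 2 * ((1 - exp (- ((1 - lam c) * s))) * inn ind c)\<^sup>2"
      by (simp add: power_mult_distrib mult_ac)
  qed
  also have "\<dots> \<le> (\<Sum>c\<in>C. 2 * ((1 - exp (- ((1 - lam c) * s))) * inn ind c)\<^sup>2)"
    using basis_finite[OF basis] by (intro sum_mono2) auto
  also have "\<dots> = 2 * inn (ind - surv s) (ind - surv s)"
  proof -
    have supp: "ind - surv s \<in> supported_on (- A)"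
      by (intro subspace_diff subspace_supported_on indicator_vec_supported survival_supported)
    have "inn (ind - surv s) c = (1 - exp (- ((1 - lam c) * s))) * inn ind c" if "c \<in> C" for c
      by (simp add: weighted_inner_diff_left survival_coefficient[OF that] left_diff_distrib)
    thus ?thesis
      by (subst parseval[OF basis supp, of "ind - surv s"]) (simp add: sum_distrib_left power2_eq_square)
  qed
  also have "inn (ind - surv s) (ind - surv s) \<le> (\<Sum>x\<in>UNIV. pmf \<pi> x * (?f x)\<^sup>2)"
    unfolding weighted_inner_def
  proof (rule sum_mono)
    fix x
    show "pmf \<pi> x * (ind - surv s) $ x * (ind - surv s) $ x \<le> pmf \<pi> x * (?f x)\<^sup>2"
    proof (cases "x \<in> A")
      case True
      thus ?thesis using survival_supported[of s] by (simp add: supported_on_def indicator_vec_def)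
    next
      case False
      thus ?thesis by (simp add: f indicator_vec_def power2_eq_square mult.assoc)
    qed
  qed
  finally show ?thesis by (simp add: s_def)
qed

end

text \<open>
  Here \<open>g = 1 - \<rho>\<close> is the exponential rate of the hitting time from the quasi-stationary distribution,
  and \<open>a\<close> is the squared coefficient of the indicator of \<open>- A\<close> along one eigenvector for \<open>\<rho>\<close>.
  Both ratios of the main statement are then trapped between \<open>a\<close> and \<open>1 - \<pi>(A)\<close>.
\<close>
theorem hitting_time_comparison:
  assumes A: "A \<noteq> {}" "A \<noteq> UNIV"
    and M: "M \<in> irreducible_components P (- A)"
    and maximal: "\<forall>M' \<in> irreducible_components P (- A).
      expected_hitting_time P (quasi_stationary P M') A
        \<le> expected_hitting_time P (quasi_stationary P M) A"
  obtains a g where "0 < g" "0 \<le> a" "a \<le> 1 - measure_pmf.prob \<pi> A"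
    "1 - a \<le> measure_pmf.prob \<pi> A +
       2 * (\<Sum>x\<in>UNIV. pmf \<pi> x * (chain_prob P (return_pmf x)
            (\<lambda>\<omega>. hitting_time A \<omega> \<le> ennreal (2 * relaxation_time P)))\<^sup>2)"
    "\<And>t. 0 \<le> t \<Longrightarrow> chain_prob P (quasi_stationary P M) (\<lambda>\<omega>. hitting_time A \<omega> > ennreal t) = exp (- (g * t))"
    "\<And>t. 0 \<le> t \<Longrightarrow> a * exp (- (g * t)) \<le> chain_prob P \<pi> (\<lambda>\<omega>. hitting_time A \<omega> > ennreal t)"
    "\<And>t. 0 \<le> t \<Longrightarrow> chain_prob P \<pi> (\<lambda>\<omega>. hitting_time A \<omega> > ennreal t) \<le>
       (1 - measure_pmf.prob \<pi> A) * exp (- (g * t))"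
    "expected_hitting_time P (quasi_stationary P M) A = ennreal (1 / g)"
proof -
  obtain C lam where basis: "eigenbasis (- A) C lam" using eigenbasis_exists by blast
  note inner = irreducible_component_is_inner[OF M]
  let ?ind = "indicator_vec (- A) :: real^'s"
  let ?r = "spectral_radius (K M)"
  obtain c0 where c0: "c0 \<in> C" "lam c0 = ?r"
    using component_spectral_radius(1)[OF basis inner] by auto
  have le: "lam c \<le> ?r" if "c \<in> C" for c
    by (rule maximal_component_spectral_radius[OF basis A(1) M maximal that])
  have fin: "finite C" by (rule basis_finite[OF basis])
  show thesis
  proof (rule that[of "1 - ?r" "(inn ?ind c0)\<^sup>2"])
    show "0 < 1 - ?r" using component_spectral_radius(2)[OF basis inner A(1)] by simp
    show "(inn ?ind c0)\<^sup>2 \<le> 1 - measure_pmf.prob \<pi> A"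
      unfolding indicator_coefficients_sum[OF basis, symmetric]
      using c0(1) fin by (intro member_le_sum[of c0 C "\<lambda>c. (inn ?ind c)\<^sup>2"]) auto
    show "1 - (inn ?ind c0)\<^sup>2 \<le> measure_pmf.prob \<pi> A +
       2 * (\<Sum>x\<in>UNIV. pmf \<pi> x * (chain_prob P (return_pmf x)
            (\<lambda>\<omega>. hitting_time A \<omega> \<le> ennreal (2 * relaxation_time P)))\<^sup>2)"
      by (rule hitting_square_bound[OF basis A c0(1)]) (simp add: c0(2) le)
    fix t :: real assume t: "0 \<le> t"
    show "chain_prob P (quasi_stationary P M) (\<lambda>\<omega>. hitting_time A \<omega> > ennreal t) = exp (- ((1 - ?r) * t))"
      by (rule quasi_stationary_survival[OF basis inner t])
    have "exp (- ((1 - lam c0) * t)) * (inn ?ind c0)\<^sup>2 \<le> (\<Sum>c\<in>C. exp (- ((1 - lam c) * t)) * (inn ?ind c)\<^sup>2)"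
      using fin c0(1) by (intro member_le_sum[of c0 C "\<lambda>c. exp (- ((1 - lam c) * t)) * (inn ?ind c)\<^sup>2"]) auto
    thus "(inn ?ind c0)\<^sup>2 * exp (- ((1 - ?r) * t)) \<le> chain_prob P \<pi> (\<lambda>\<omega>. hitting_time A \<omega> > ennreal t)"
      by (simp add: survival_from_stationarity[OF basis t] c0(2) mult.commute)
    have "(\<Sum>c\<in>C. exp (- ((1 - lam c) * t)) * (inn ?ind c)\<^sup>2) \<le>
        (\<Sum>c\<in>C. exp (- ((1 - ?r) * t)) * (inn ?ind c)\<^sup>2)"
      using le t by (intro sum_mono mult_right_mono) (auto intro: mult_right_mono)
    also have "\<dots> = (1 - measure_pmf.prob \<pi> A) * exp (- ((1 - ?r) * t))"
      unfolding indicator_coefficients_sum[OF basis, symmetric] sum_distrib_right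
      by (intro sum.cong refl mult.commute)
    finally show "chain_prob P \<pi> (\<lambda>\<omega>. hitting_time A \<omega> > ennreal t) \<le>
       (1 - measure_pmf.prob \<pi> A) * exp (- ((1 - ?r) * t))"
      by (simp add: survival_from_stationarity[OF basis t])
  next
    show "expected_hitting_time P (quasi_stationary P M) A = ennreal (1 / (1 - ?r))"
      by (rule quasi_stationary_expected[OF basis A(1) inner])
  qed simp
qed

end

theorem theorem1p2:
  fixes P :: "'s::finite \<Rightarrow> 's pmf" and \<pi> :: "'s pmf" and A M :: "'s set"
  assumes irreducible: "irreducible_kernel P"
    and reversible: "reversible_kernel P \<pi>"
    and A: "A \<noteq> {}" "A \<noteq> UNIV"
    and M: "M \<in> irreducible_components P (- A)"
    and maximal: "\<forall>M' \<in> irreducible_components P (- A).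
      expected_hitting_time P (quasi_stationary P M') A
        \<le> expected_hitting_time P (quasi_stationary P M) A"
  shows
    "let \<alpha> = quasi_stationary P M;
         lower = measure_pmf.prob \<pi> A;
         upper = measure_pmf.prob \<pi> A +
           2 * (\<Sum>x\<in>UNIV. pmf \<pi> x *
             (chain_prob P (return_pmf x)
                (\<lambda>\<omega>. hitting_time A \<omega> \<le> ennreal (2 * relaxation_time P)))\<^sup>2)
     in (\<forall>t\<ge>0.
          lower \<le> 1 - chain_prob P \<pi> (\<lambda>\<omega>. hitting_time A \<omega> > ennreal t)
                      / chain_prob P \<alpha> (\<lambda>\<omega>. hitting_time A \<omega> > ennreal t) \<and>
          1 - chain_prob P \<pi> (\<lambda>\<omega>. hitting_time A \<omega> > ennreal t)
                / chain_prob P \<alpha> (\<lambda>\<omega>. hitting_time A \<omega> > ennreal t) \<le> upper) \<and>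
        lower \<le> 1 - enn2real (expected_hitting_time P \<pi> A)
                    / enn2real (expected_hitting_time P \<alpha> A) \<and>
        1 - enn2real (expected_hitting_time P \<pi> A)
              / enn2real (expected_hitting_time P \<alpha> A) \<le> upper"
proof -
  interpret reversible_chain P \<pi> by unfold_locales fact+
  let ?\<alpha> = "quasi_stationary P M"
  let ?lower = "measure_pmf.prob \<pi> A"
  let ?upper = "measure_pmf.prob \<pi> A + 2 * (\<Sum>x\<in>UNIV. pmf \<pi> x *
    (chain_prob P (return_pmf x) (\<lambda>\<omega>. hitting_time A \<omega> \<le> ennreal (2 * relaxation_time P)))\<^sup>2)"
  let ?surv = "\<lambda>\<mu> t. chain_prob P \<mu> (\<lambda>\<omega>. hitting_time A \<omega> > ennreal t)"
  obtain a g where g: "0 < g" and a: "0 \<le> a" "a \<le> 1 - ?lower" "1 - a \<le> ?upper"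
    and qs: "\<And>t. 0 \<le> t \<Longrightarrow> ?surv ?\<alpha> t = exp (- (g * t))"
    and low: "\<And>t. 0 \<le> t \<Longrightarrow> a * exp (- (g * t)) \<le> ?surv \<pi> t"
    and up: "\<And>t. 0 \<le> t \<Longrightarrow> ?surv \<pi> t \<le> (1 - ?lower) * exp (- (g * t))"
    and E\<alpha>: "expected_hitting_time P ?\<alpha> A = ennreal (1 / g)"
    by (rule hitting_time_comparison[OF A M maximal]) (rule that; assumption)
  have ratio: "?lower \<le> 1 - ?surv \<pi> t / ?surv ?\<alpha> t \<and> 1 - ?surv \<pi> t / ?surv ?\<alpha> t \<le> ?upper"
    if t: "0 \<le> t" for t
  proof -
    have "a \<le> ?surv \<pi> t / ?surv ?\<alpha> t" "?surv \<pi> t / ?surv ?\<alpha> t \<le> 1 - ?lower"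
      using low[OF t] up[OF t] by (simp_all add: qs[OF t] pos_le_divide_eq pos_divide_le_eq)
    thus ?thesis using a(3) by linarith
  qed
  have E\<pi>_up: "expected_hitting_time P \<pi> A \<le> ennreal ((1 - ?lower) / g)"
  proof -
    have "expected_hitting_time P \<pi> A \<le>
        (\<integral>\<^sup>+ t. indicator {0..} t * ennreal ((1 - ?lower) * exp (- (g * t))) \<partial>lborel)"
      unfolding expected_hitting_time_eq_integral_survival
      by (intro nn_integral_mono) (auto simp: indicator_def intro!: ennreal_leI up)
    also have "\<dots> = ennreal ((1 - ?lower) / g)"
      by (rule nn_integral_exponential_tail[OF g]) simp
    finally show ?thesis .
  qed
  have E\<pi>_low: "ennreal (a / g) \<le> expected_hitting_time P \<pi> A"
  proof -
    have "ennreal (a / g) = (\<integral>\<^sup>+ t. indicator {0..} t * ennreal (a * exp (- (g * t))) \<partial>lborel)"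
      by (rule nn_integral_exponential_tail[OF g a(1), symmetric])
    also have "\<dots> \<le> expected_hitting_time P \<pi> A"
      unfolding expected_hitting_time_eq_integral_survival
      by (intro nn_integral_mono) (auto simp: indicator_def intro!: ennreal_leI low)
    finally show ?thesis .
  qed
  define e where "e = enn2real (expected_hitting_time P \<pi> A)"
  have e: "expected_hitting_time P \<pi> A = ennreal e"
    using E\<pi>_up by (metis e_def ennreal_enn2real ennreal_less_top le_less_trans)
  have "0 \<le> e" by (simp add: e_def)
  hence "a / g \<le> e" "e \<le> (1 - ?lower) / g"
    using E\<pi>_low E\<pi>_up a g by (simp_all add: e ennreal_le_iff)
  hence "a \<le> e / (1 / g)" "e / (1 / g) \<le> 1 - ?lower"
    using g by (simp_all add: pos_divide_le_eq pos_le_divide_eq mult.commute)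
  moreover have "enn2real (expected_hitting_time P ?\<alpha> A) = 1 / g" using g by (simp add: E\<alpha>)
  ultimately show ?thesis
    using ratio a(3) unfolding Let_def e_def[symmetric] by auto
qed

end
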